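(* $\mathrm{Fair\text{-}GC}(\lfloor n/2\rfloor,\lfloor n/2\rfloor,1)\subseteq\mathrm{P\text{-}mc}(\mathrm{poly})$.
   Context: Sets are languages over $\Sigma=\{0,1\}$; FP is the class of polynomial-time computable functions; $\chi_A$ is the characteristic function of $A$. For nondecreasing threshold functions $g_1,g_2,g_3:\mathbb{N}^+\to\mathbb{N}^+$, $\mathrm{GC}(g_1,g_2,g_3)$ is the class of sets $L$ for which there is an FP function $f$ such that for every $n\geq1$ and all distinct strings $y_1,\dots,y_n$ (given as a tuple in lexicographic order): $f(y_1,\dots,y_n)\subseteq\{y_1,\dots,y_n\}$, $\|f(y_1,\dots,y_n)\|\leq g_2(n)$, and if $\|L\cap\{y_1,\dots,y_n\}\|\geq g_1(n)$ then $\|L\cap f(y_1,\dots,y_n)\|\geq g_3(n)$. $\mathrm{Fair\text{-}GC}(g_1,g_2,g_3)$ is defined the same way but the conditions are required only for inputs of $n$ distinct strings each of length at most $n$. Here $g_1(n)=g_2(n)=\lfloor n/2\rfloor$ and $g_3(n)=1$. For a monotone nondecreasing, polynomially bounded FP function $g:\mathbb{N}\to\mathbb{N}^+$, $\mathrm{P\text{-}mc}(g)$ is the class of sets $A$ having a polynomial-time computable $f$ such that for all $z_1,\dots,z_m$ with $m\geq g(\max\{|z_1|,\dots,|z_m|\})$, $f(z_1,\dots,z_m)\in\{0,1\}^m$ and $(\chi_A(z_1),\dots,\chi_A(z_m))\neq f(z_1,\dots,z_m)$. $\mathrm{P\text{-}mc}(\mathrm{poly})=\bigcup\{\mathrm{P\text{-}mc}(p):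 p\text{ a polynomial}\}$. *)

theory Defs
  imports Complex_Main "HOL-Computational_Algebra.Polynomial"
begin

text \<open>Deterministic multitape Turing machines with two-way infinite tapes. \<open>Sep\<close> is the comma
  used to write tuples of binary strings; \<open>Aux\<close> supplies further work symbols.\<close>

datatype symbol = Blank | Bit bool | Sep | Aux nat

datatype move = Go_Left | Stay | Go_Right

fun displacement :: "move \<Rightarrow> int" where
  "displacement Go_Left = -1"
| "displacement Stay = 0"
| "displacement Go_Right = 1"

record tm =
  tapes :: nat
  states :: "nat set"
  alphabet :: "symbol set"
  start :: nat
  halt :: nat
  delta :: "nat \<Rightarrow> symbol list \<Rightarrow> nat \<times> (symbol \<times> move) list"

definition wf_tm :: "tm \<Rightarrow> bool" where
  "wf_tm M \<longleftrightarrow>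
     1 \<le> tapes M \<and>
     finite (states M) \<and> start M \<in> states M \<and> halt M \<in> states M \<and>
     finite (alphabet M) \<and> {Blank, Bit False, Bit True, Sep} \<subseteq> alphabet M \<and>
     (\<forall>q \<in> states M. \<forall>as. length as = tapes M \<and> set as \<subseteq> alphabet M \<longrightarrow>
        fst (delta M q as) \<in> states M \<and>
        length (snd (delta M q as)) = tapes M \<and>
        fst ` set (snd (delta M q as)) \<subseteq> alphabet M)"

type_synonym tape = "(int \<Rightarrow> symbol) \<times> int"

type_synonym config = "nat \<times> tape list"

definition act :: "tape \<Rightarrow> symbol \<times> move \<Rightarrow> tape" where
  "act t a = ((fst t)(snd t := fst a), snd t + displacement (snd a))"

definition step :: "tm \<Rightarrow> config \<Rightarrow> config" where
  "step M c =
     (if fst c = halt M then c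
      else let r = delta M (fst c) (map (\<lambda>t. fst t (snd t)) (snd c))
           in (fst r, map2 act (snd c) (snd r)))"

definition inscription :: "symbol list \<Rightarrow> int \<Rightarrow> symbol" where
  "inscription w i = (if 0 \<le> i \<and> i < int (length w) then w ! nat i else Blank)"

definition initial :: "tm \<Rightarrow> symbol list \<Rightarrow> config" where
  "initial M w =
     (start M, (inscription w, 0) # replicate (tapes M - 1) (\<lambda>_. Blank, 0))"

text \<open>The first tape carries the input and, on halting, exactly the output. \<open>FP ei eo f\<close>: the
  total function \<open>f\<close> is computable in time polynomial in the length of the input, with arguments
  written by \<open>ei\<close> and values by \<open>eo\<close>.\<close>

definition FP :: "('a \<Rightarrow> symbol list) \<Rightarrow> ('b \<Rightarrow> symbol list) \<Rightarrow> ('a \<Rightarrow> 'b) \<Rightarrow> bool" where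
  "FP ei eo f \<longleftrightarrow>
     (\<exists>M. \<exists>p :: nat poly. wf_tm M \<and>
        (\<forall>x. \<exists>t \<le> poly p (length (ei x)).
           let c = (step M ^^ t) (initial M (ei x))
           in fst c = halt M \<and> fst (hd (snd c)) = inscription (eo (f x))))"

definition enc_string :: "bool list \<Rightarrow> symbol list" where
  "enc_string z = map Bit z"

definition enc_tuple :: "bool list list \<Rightarrow> symbol list" where
  "enc_tuple zs = concat (map (\<lambda>z. enc_string z @ [Sep]) zs)"

definition lex_less :: "bool list \<Rightarrow> bool list \<Rightarrow> bool" where
  "lex_less u v \<longleftrightarrow> (u, v) \<in> lexord {(a, b). a < b}"

text \<open>Strict sortedness makes the components of \<open>ys\<close> distinct. The value \<open>f ys\<close> lists the
  elements of the selected set, in any order.\<close>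

definition Fair_GC ::
    "(nat \<Rightarrow> nat) \<Rightarrow> (nat \<Rightarrow> nat) \<Rightarrow> (nat \<Rightarrow> nat) \<Rightarrow> bool list set set" where
  "Fair_GC g1 g2 g3 =
     {L. \<exists>f. FP enc_tuple enc_tuple f \<and>
        (\<forall>n ys. n \<ge> 1 \<and> length ys = n \<and> sorted_wrt lex_less ys \<and>
             (\<forall>y \<in> set ys. length y \<le> n) \<longrightarrow>
           set (f ys) \<subseteq> set ys \<and>
           card (set (f ys)) \<le> g2 n \<and>
           (card (L \<inter> set ys) \<ge> g1 n \<longrightarrow> card (L \<inter> set (f ys)) \<ge> g3 n))}"

definition threshold :: "(nat \<Rightarrow> nat) \<Rightarrow> bool" where
  "threshold g \<longleftrightarrow> (\<forall>n \<ge> 1. g n \<ge> 1) \<and> (\<forall>m n. 1 \<le> m \<and> m \<le> n \<longrightarrow> g m \<le> g n)"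

text \<open>Threshold functions take positive values, so \<open>\<lfloor>n/2\<rfloor>\<close> has to be read as 1 at \<open>n = 1\<close>. By
  \<open>half_unique\<close> this is the only possible reading as a threshold function; by
  \<open>Fair_GC_floor_empty\<close> the value 0 at \<open>n = 1\<close> would make the class empty.\<close>

definition half :: "nat \<Rightarrow> nat" where
  "half n = max 1 (n div 2)"

lemma threshold_half: "threshold half"
  unfolding threshold_def half_def by (auto intro: le_max_iff_disj[THEN iffD2] div_le_mono)

lemma half_unique:
  assumes "threshold g" "\<And>n. n \<ge> 2 \<Longrightarrow> g n = n div 2" "n \<ge> 1"
  shows "g n = half n"
proof (cases "n = 1")
  case True
  have "1 \<le> g 1" "g 1 \<le> g 2"
    using assms(1) unfolding threshold_def by auto
  moreover have "g 2 = 1"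
    using assms(2)[of 2] by simp
  ultimately show ?thesis
    using True by (simp add: half_def)
next
  case False
  then show ?thesis
    using assms(2)[of n] assms(3) by (simp add: half_def)
qed

lemma Fair_GC_floor_empty: "Fair_GC (\<lambda>n. n div 2) (\<lambda>n. n div 2) (\<lambda>n. 1) = {}"
proof -
  have False if L: "L \<in> Fair_GC (\<lambda>n. n div 2) (\<lambda>n. n div 2) (\<lambda>n. 1)" for L
  proof -
    obtain f where f: "\<forall>n ys. n \<ge> 1 \<and> length ys = n \<and> sorted_wrt lex_less ys \<and>
             (\<forall>y \<in> set ys. length y \<le> n) \<longrightarrow>
           set (f ys) \<subseteq> set ys \<and> card (set (f ys)) \<le> n div 2 \<and>
           (card (L \<inter> set ys) \<ge> n div 2 \<longrightarrow> card (L \<inter> set (f ys)) \<ge> 1)"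
      using L unfolding Fair_GC_def by blast
    show False
      using f[rule_format, of 1 "[[]]"] by auto
  qed
  then show ?thesis
    by blast
qed

definition P_mc :: "(nat \<Rightarrow> nat) \<Rightarrow> bool list set set" where
  "P_mc g =
     {A. \<exists>f. FP enc_tuple enc_string f \<and>
        (\<forall>zs. zs \<noteq> [] \<and> length zs \<ge> g (Max (length ` set zs)) \<longrightarrow>
           length (f zs) = length zs \<and> map (\<lambda>z. z \<in> A) zs \<noteq> f zs)}"

text \<open>Polynomials with arbitrary coefficients, as long as they are nondecreasing maps from the
  natural numbers to the positive natural numbers.\<close>

definition P_mc_poly :: "bool list set set" where
  "P_mc_poly =
     \<Union> {P_mc g | g. mono g \<and> (\<forall>n. g n \<ge> 1) \<and>
           (\<exists>p :: real poly. \<forall>n. real (g n) = poly p (real n))}"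

end

theory Submission imports Defs begin

text \<open>Given distinct \<open>zs\<close> with \<open>n = length zs \<ge> 2\<close> exceeding all their lengths, let \<open>F\<close> be the set
  selected by \<open>f\<close> from the sorted tuple, and answer 0 on \<open>F\<close> and 1 elsewhere. If this vector were
  correct, then \<open>L\<close> would contain the at least \<open>n - \<lfloor>n/2\<rfloor> \<ge> \<lfloor>n/2\<rfloor>\<close> strings outside \<open>F\<close>, hence
  meet \<open>F\<close>, where the answer is 0. If \<open>zs\<close> has repetitions, two different answers for the same
  string suffice; flipping the answer with every earlier occurrence serves both cases at once.

  Computability in polynomial time is shown with a small imperative language on tapes; the
  continuation of a program serves as the state of the compiled Turing machine.\<close>

section \<open>Imperative programs on tapes\<close>

text \<open>The selector \<open>f\<close> is guaranteed only on strictly sorted tuples, whereas the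
  queries of \<open>P_mc\<close> come in any order and possibly repeated. Sorting settles the order;
  repetitions are left in. Nothing is then known about \<open>f (isort zs)\<close>, but the flipping
  argument works for whatever strings \<open>f\<close> returns. The computation remains polynomial
  on such inputs as well, because \<open>f\<close> is total and its machine keeps its time bound on
  every tuple.

  Fairness is met by the threshold \<open>n + 2\<close>, where \<open>n\<close> is the greatest
  length of a query: the number of queries then exceeds every length, so the restricted guarantee of
  the class applies.

  The bulk of the work is \<open>FP\<close> itself, which asks for a concrete machine whose first
  tape ends up with exactly the encoded value, starting at cell 0. One further obstacle is the size
  of the selected list: \<open>f\<close> may list a string several times, so that its length has to
  be bounded through the running time of its machine.\<close>

datatype cmd =
    Act "(nat \<Rightarrow> symbol) \<Rightarrow> nat \<Rightarrow> symbol \<times> move"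
  | Seq cmd cmd  (infixr ";;" 60)
  | Branch "(nat \<Rightarrow> symbol) \<Rightarrow> bool" cmd cmd
  | Loop "(nat \<Rightarrow> symbol) \<Rightarrow> bool" cmd

type_synonym store = "nat \<Rightarrow> tape"

definition scan :: "tape \<Rightarrow> symbol" where
  "scan t = fst t (snd t)"

definition idle :: "(nat \<Rightarrow> symbol) \<Rightarrow> nat \<Rightarrow> symbol \<times> move" where
  "idle h i = (h i, Stay)"

text \<open>Unfolding a \<open>Seq\<close>, \<open>Branch\<close> or \<open>Loop\<close> is a step
  of its own, during which \<open>action\<close> leaves all tapes alone; this step is the
  \<open>Suc\<close> in the rules below. The empty continuation is a fixed point, as a halted
  configuration is for \<open>step\<close>.\<close>

fun ctrl :: "cmd list \<Rightarrow> (nat \<Rightarrow> symbol) \<Rightarrow> cmd list" where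
  "ctrl [] h = []"
| "ctrl (Act a # ks) h = ks"
| "ctrl ((c ;; d) # ks) h = c # d # ks"
| "ctrl (Branch b c d # ks) h = (if b h then c else d) # ks"
| "ctrl (Loop b c # ks) h = (if b h then c # Loop b c # ks else ks)"

fun action :: "cmd list \<Rightarrow> (nat \<Rightarrow> symbol) \<Rightarrow> nat \<Rightarrow> symbol \<times> move" where
  "action (Act a # ks) = a"
| "action _ = idle"

definition cstep :: "cmd list \<times> store \<Rightarrow> cmd list \<times> store" where
  "cstep s = (let h = scan \<circ> snd s
     in (ctrl (fst s) h, \<lambda>i. act (snd s i) (action (fst s) h i)))"

text \<open>The number \<open>n\<close> is only an upper bound on the running time.\<close>

definition runs :: "cmd \<Rightarrow> store \<Rightarrow> nat \<Rightarrow> store \<Rightarrow> bool" where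
  "runs c T n T' \<longleftrightarrow> (\<exists>t \<le> n. \<forall>ks. (cstep ^^ t) (c # ks, T) = (ks, T'))"

lemma act_idle [simp]: "act t (scan t, Stay) = t"
  by (simp add: act_def scan_def)

lemma runs_mono: "runs c T n T' \<Longrightarrow> n \<le> n' \<Longrightarrow> runs c T n' T'"
  unfolding runs_def by (meson le_trans)

text \<open>The final store is a variable tied by an equation, here and in the rules for commands
  below, so that the store can be written in the form that the next command expects; the equation is
  then checked tape by tape.\<close>

lemma runs_Act: "1 \<le> n \<Longrightarrow> T' = (\<lambda>i. act (T i) (a (scan \<circ> T) i)) \<Longrightarrow> runs (Act a) T n T'"
  unfolding runs_def by (rule exI[of _ 1]) (simp add: cstep_def)

lemma runs_Seq:
  assumes "runs c T m T'" "runs d T' n T''" "Suc (m + n) \<le> k"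
  shows "runs (c ;; d) T k T''"
proof -
  obtain s t where s: "s \<le> m" "\<And>ks. (cstep ^^ s) (c # ks, T) = (ks, T')"
    and t: "t \<le> n" "\<And>ks. (cstep ^^ t) (d # ks, T') = (ks, T'')"
    using assms(1,2) unfolding runs_def by blast
  have "(cstep ^^ (t + s + 1)) ((c ;; d) # ks, T) = (ks, T'')" for ks
  proof -
    have "cstep ((c ;; d) # ks, T) = (c # d # ks, T)"
      by (simp add: cstep_def idle_def)
    then show ?thesis
      unfolding funpow_add by (simp add: s t)
  qed
  then show ?thesis
    unfolding runs_def using s(1) t(1) assms(3) by (intro exI[of _ "t + s + 1"]) simp
qed

lemma runs_Branch:
  assumes "runs (if b (scan \<circ> T) then c else d) T n T'" "Suc n \<le> k"
  shows "runs (Branch b c d) T k T'"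
proof -
  obtain t where t: "t \<le> n" "\<And>ks. (cstep ^^ t) ((if b (scan \<circ> T) then c else d) # ks, T) = (ks, T')"
    using assms(1) unfolding runs_def by blast
  have "(cstep ^^ (t + 1)) (Branch b c d # ks, T) = (ks, T')" for ks
  proof -
    have "cstep (Branch b c d # ks, T) = ((if b (scan \<circ> T) then c else d) # ks, T)"
      by (simp add: cstep_def idle_def)
    then show ?thesis
      using t(2)[of ks] unfolding funpow_add by simp
  qed
  then show ?thesis
    unfolding runs_def using t(1) assms(2) by (intro exI[of _ "t + 1"]) simp
qed

lemma runs_Branch_True:
  "b (scan \<circ> T) \<Longrightarrow> runs c T n T' \<Longrightarrow> Suc n \<le> k \<Longrightarrow> runs (Branch b c d) T k T'"
  by (rule runs_Branch) auto

lemma runs_Branch_False: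
  "\<not> b (scan \<circ> T) \<Longrightarrow> runs d T n T' \<Longrightarrow> Suc n \<le> k \<Longrightarrow> runs (Branch b c d) T k T'"
  by (rule runs_Branch) auto

lemma runs_Loop_exit: "\<not> b (scan \<circ> T) \<Longrightarrow> 1 \<le> n \<Longrightarrow> T' = T \<Longrightarrow> runs (Loop b c) T n T'"
  unfolding runs_def by (rule exI[of _ 1]) (simp add: cstep_def idle_def)

lemma runs_Loop_enter:
  assumes "b (scan \<circ> T)" "runs c T m T'" "runs (Loop b c) T' n T''" "Suc (m + n) \<le> k"
  shows "runs (Loop b c) T k T''"
proof -
  obtain s t where s: "s \<le> m" "\<And>ks. (cstep ^^ s) (c # ks, T) = (ks, T')"
    and t: "t \<le> n" "\<And>ks. (cstep ^^ t) (Loop b c # ks, T') = (ks, T'')"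
    using assms(2,3) unfolding runs_def by blast
  have "(cstep ^^ (t + s + 1)) (Loop b c # ks, T) = (ks, T'')" for ks
  proof -
    have "cstep (Loop b c # ks, T) = (c # Loop b c # ks, T)"
      using assms(1) by (simp add: cstep_def idle_def)
    then show ?thesis
      unfolding funpow_add by (simp add: s t)
  qed
  then show ?thesis
    unfolding runs_def using s(1) t(1) assms(4) by (intro exI[of _ "t + s + 1"]) simp
qed

text \<open>The continuations that occur while \<open>c\<close> is executed in front of \<open>ks\<close>, without \<open>ks\<close> itself.\<close>

primrec conts :: "cmd \<Rightarrow> cmd list \<Rightarrow> cmd list set" where
  "conts (Act a) ks = {Act a # ks}"
| "conts (c ;; d) ks = insert ((c ;; d) # ks) (conts c (d # ks) \<union> conts d ks)"
| "conts (Branch b c d) ks = insert (Branch b c d # ks) (conts c ks \<union> conts d ks)"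
| "conts (Loop b c) ks = insert (Loop b c # ks) (conts c (Loop b c # ks))"

lemma finite_conts: "finite (conts c ks)"
  by (induction c arbitrary: ks) auto

lemma conts_self: "c # ks \<in> conts c ks"
  by (cases c) auto

text \<open>Since a loop body runs in front of the loop itself, repeated rounds produce no new
  continuations. With \<open>finite_conts\<close>, closure under \<open>ctrl\<close> yields a finite
  set of machine states.\<close>

lemma ctrl_conts: "x \<in> conts c ks \<Longrightarrow> ctrl x h \<in> insert ks (conts c ks)"
proof (induction c arbitrary: ks x)
  case (Act a)
  then show ?case by simp
next
  case (Seq c d)
  then show ?case
    using conts_self by fastforce
next
  case (Branch b c d)
  from Branch.prems consider "x = Branch b c d # ks" | "x \<in> conts c ks" | "x \<in> conts d ks"
    by auto
  then show ?case
    by cases (use Branch.IH conts_self[of c ks] conts_self[of d ks] in auto)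
next
  case (Loop b c)
  then show ?case
    using conts_self[of c "Loop b c # ks"] by fastforce
qed

section \<open>Compiling programs into Turing machines\<close>

definition local_on :: "nat \<Rightarrow> ((nat \<Rightarrow> symbol) \<Rightarrow> 'a) \<Rightarrow> bool" where
  "local_on K g \<longleftrightarrow> (\<forall>h h'. (\<forall>i<K. h i = h' i) \<longrightarrow> g h = g h')"

text \<open>A store has infinitely many tapes and symbols, a machine only \<open>K\<close> tapes and
  a finite alphabet. What happens on the first \<open>K\<close> tapes must therefore be determined
  by their scanned symbols, and must not lead out of \<open>A\<close>.\<close>

primrec wf_cmd :: "nat \<Rightarrow> symbol set \<Rightarrow> cmd \<Rightarrow> bool" where
  "wf_cmd K A (Act a) \<longleftrightarrow> (\<forall>i<K. local_on K (\<lambda>h. a h i)) \<and>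
     (\<forall>h. (\<forall>i<K. h i \<in> A) \<longrightarrow> (\<forall>i<K. fst (a h i) \<in> A))"
| "wf_cmd K A (c ;; d) \<longleftrightarrow> wf_cmd K A c \<and> wf_cmd K A d"
| "wf_cmd K A (Branch b c d) \<longleftrightarrow> local_on K b \<and> wf_cmd K A c \<and> wf_cmd K A d"
| "wf_cmd K A (Loop b c) \<longleftrightarrow> local_on K b \<and> wf_cmd K A c"

lemma wf_conts:
  "wf_cmd K A c \<Longrightarrow> (\<forall>d \<in> set ks. wf_cmd K A d) \<Longrightarrow> x \<in> conts c ks \<Longrightarrow> d \<in> set x \<Longrightarrow> wf_cmd K A d"
proof (induction c arbitrary: ks x)
  case (Act a)
  then show ?case by auto
next
  case (Seq c1 c2)
  from Seq.prems(3) consider "x = (c1 ;; c2) # ks" | "x \<in> conts c1 (c2 # ks)" | "x \<in> conts c2 ks"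
    by auto
  then show ?case
    by cases (use Seq.prems Seq.IH(1)[of "c2 # ks" x] Seq.IH(2)[of ks x] in auto)
next
  case (Branch b c1 c2)
  from Branch.prems(3) consider "x = Branch b c1 c2 # ks" | "x \<in> conts c1 ks" | "x \<in> conts c2 ks"
    by auto
  then show ?case
    by cases (use Branch.prems Branch.IH(1)[of ks x] Branch.IH(2)[of ks x] in auto)
next
  case (Loop b c)
  from Loop.prems(3) consider "x = Loop b c # ks" | "x \<in> conts c (Loop b c # ks)"
    by auto
  then show ?case
    by cases (use Loop.prems Loop.IH[of "Loop b c # ks" x] in auto)
qed

text \<open>\<open>l\<close> is the part to the left of the head, nearest cell first; the origin is its far end, so
  that the position of the head is determined by \<open>l\<close>.\<close>

definition mk :: "symbol list \<Rightarrow> symbol list \<Rightarrow> tape" where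
  "mk l r = (inscription (rev l @ r), int (length l))"

definition init_store :: "symbol list \<Rightarrow> store" where
  "init_store w = (\<lambda>_. mk [] [])(0 := mk [] w)"

text \<open>The finitely many continuations of \<open>P\<close> are numbered injectively, the empty
  one becoming the halting state. The map \<open>rep\<close>, which forgets the tapes from
  \<open>K\<close> on, commutes with single steps, so the time bound carries over unchanged.\<close>

lemma FP_cmd:
  fixes K :: nat and p :: "nat poly"
  assumes K: "1 \<le> K" and A: "finite A" "{Blank, Bit False, Bit True, Sep} \<subseteq> A"
    and wf: "wf_cmd K A P"
    and run: "\<And>x. \<exists>T. runs P (init_store (ei x)) (poly p (length (ei x))) T \<and>
                 fst (T 0) = inscription (eo (f x))"
  shows "FP ei eo f"
proof -
  define S where "S = insert [] (conts P [])"
  have finS: "finite S"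
    by (simp add: S_def finite_conts)
  have ctrlS: "ctrl x h \<in> S" if "x \<in> S" for x h
    using that ctrl_conts[of x P "[]" h] by (auto simp: S_def)
  have wfS: "wf_cmd K A d" if "x \<in> S" "d \<in> set x" for x d
    using that wf_conts[OF wf, of "[]" x d] by (auto simp: S_def)
  obtain e :: "cmd list \<Rightarrow> nat" where e: "inj_on e S"
    using finite_imp_inj_to_nat_seg[OF finS] by blast
  define dec where "dec = inv_into S e"
  have dec [simp]: "dec (e x) = x" if "x \<in> S" for x
    using that e by (simp add: dec_def)
  \<comment> \<open>Commands expect a symbol for every tape; by \<open>local_on\<close>, the value
    filled in from \<open>K\<close> on has no influence on the first \<open>K\<close> tapes.\<close>
  define hd_of where "hd_of as i = (if i < K then as ! i else Blank)" for as :: "symbol list" and i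
  define M where "M = \<lparr>tapes = K, states = e ` S, alphabet = A, start = e [P], halt = e [],
      delta = (\<lambda>q as. (e (ctrl (dec q) (hd_of as)), map (action (dec q) (hd_of as)) [0..<K]))\<rparr>"
  have M_simps [simp]: "tapes M = K" "states M = e ` S" "alphabet M = A" "start M = e [P]"
    "halt M = e []"
    "delta M q as = (e (ctrl (dec q) (hd_of as)), map (action (dec q) (hd_of as)) [0..<K])" for q as
    by (simp_all add: M_def)
  have PS: "[P] \<in> S" "[] \<in> S"
    by (auto simp: S_def conts_self)
  have action_A: "fst (action x h i) \<in> A" if "x \<in> S" "\<forall>i<K. h i \<in> A" "i < K" for x h i
  proof (cases x)
    case (Cons c ks)
    then have "wf_cmd K A c"
      using wfS[OF that(1)] by simp
    then show ?thesis
      using that(2,3) Cons by (cases c) (auto simp: idle_def)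
  qed (use that in \<open>simp add: idle_def\<close>)
  have wfM: "wf_tm M"
    unfolding wf_tm_def M_simps
  proof (intro conjI ballI allI impI)
    fix q as assume q: "q \<in> e ` S" and as: "length as = K \<and> set as \<subseteq> A"
    obtain x where x: "x \<in> S" "q = e x"
      using q by blast
    have h: "\<forall>i<K. hd_of as i \<in> A"
      using as nth_mem[of _ as] by (auto simp: hd_of_def)
    show "fst (e (ctrl (dec q) (hd_of as)), map (action (dec q) (hd_of as)) [0..<K]) \<in> e ` S"
      using x ctrlS by simp
    show "fst ` set (snd (e (ctrl (dec q) (hd_of as)), map (action (dec q) (hd_of as)) [0..<K])) \<subseteq> A"
      using x action_A[OF x(1) h] by auto
  qed (use K A finS PS in auto)
  define rep where "rep s = (e (fst s), map (snd s) [0..<K])" for s :: "cmd list \<times> store"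
  have step_rep: "step M (rep s) = rep (cstep s)" if s: "fst s \<in> S" for s
  proof (cases "fst s = []")
    case True
    then show ?thesis
      by (auto simp: step_def rep_def cstep_def idle_def fun_eq_iff)
  next
    case False
    obtain c ks where c: "fst s = c # ks"
      using False by (cases "fst s") auto
    \<comment> \<open>Injectivity of \<open>e\<close> ensures that no unfinished continuation is
      coded by the halting state.\<close>
    have ne: "e (fst s) \<noteq> e []"
      using False e s PS(2) by (auto dest: inj_onD)
    define h where "h = hd_of (map (\<lambda>t. fst t (snd t)) (map (snd s) [0..<K]))"
    have agree: "\<forall>i<K. h i = (scan \<circ> snd s) i"
      by (simp add: h_def hd_of_def scan_def)
    have wfc: "wf_cmd K A c"
      using wfS[OF s] c by simp
    have "local_on K (ctrl (fst s))" 
      using wfc unfolding c local_on_def by (cases c) (auto simp: local_on_def)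
    then have 1: "ctrl (fst s) h = ctrl (fst s) (scan \<circ> snd s)"
      using agree unfolding local_on_def by blast
    have 2: "action (fst s) h i = action (fst s) (scan \<circ> snd s) i" if "i < K" for i
    proof -
      have "local_on K (\<lambda>h. action (fst s) h i)"
        using wfc that unfolding c local_on_def by (cases c) (auto simp: local_on_def idle_def)
      then show ?thesis
        using agree unfolding local_on_def by blast
    qed
    have "step M (rep s) = (e (ctrl (fst s) h), map2 act (map (snd s) [0..<K]) (map (action (fst s) h) [0..<K]))"
      using ne s by (simp add: step_def rep_def h_def)
    also have "\<dots> = rep (cstep s)"
      using 1 2 by (auto simp: rep_def cstep_def Let_def intro!: nth_equalityI)
    finally show ?thesis .
  qed
  have cstepS: "fst (cstep s) \<in> S" if "fst s \<in> S" for s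
    using that ctrlS by (simp add: cstep_def Let_def)
  have iter: "fst ((cstep ^^ t) s) \<in> S \<and> (step M ^^ t) (rep s) = rep ((cstep ^^ t) s)"
    if "fst s \<in> S" for s t
    by (induction t) (use that cstepS step_rep in auto)
  have rep0: "rep ([P], init_store w) = initial M w" for w
  proof -
    have "[0..<K] = 0 # [1..<K]"
      using K by (simp add: upt_conv_Cons)
    moreover have "mk [] [] = (\<lambda>_. Blank, 0)"
      by (auto simp: mk_def inscription_def fun_eq_iff)
    moreover have "map (init_store w) [1..<K] = replicate (K - 1) (mk [] [])"
      by (intro nth_equalityI) (auto simp: init_store_def)
    ultimately show ?thesis
      by (simp add: rep_def initial_def init_store_def mk_def)
  qed
  show ?thesis
    unfolding FP_def
  proof (intro exI[of _ M] exI[of _ p] conjI allI wfM)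
    fix x
    obtain T where T: "runs P (init_store (ei x)) (poly p (length (ei x))) T"
      "fst (T 0) = inscription (eo (f x))"
      using run by blast
    then obtain t where t: "t \<le> poly p (length (ei x))"
      "(cstep ^^ t) ([P], init_store (ei x)) = ([], T)"
      unfolding runs_def by blast
    have "(step M ^^ t) (initial M (ei x)) = rep ([], T)"
      using iter[of "([P], init_store (ei x))" t] PS t(2) by (simp add: rep0)
    moreover have "hd (map T [0..<K]) = T 0"
      using K by (simp add: hd_map)
    ultimately show "\<exists>t\<le>poly p (length (ei x)).
           let c = (step M ^^ t) (initial M (ei x))
           in fst c = halt M \<and> fst (hd (snd c)) = inscription (eo (f x))"
      using t(1) T(2) by (intro exI[of _ t]) (simp add: rep_def)
  qed
qed

section \<open>Tapes as zippers\<close>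

text \<open>The head has run off the left end of \<open>r\<close>, onto the cell \<open>-1\<close>.\<close>

definition lft :: "symbol list \<Rightarrow> tape" where
  "lft r = (inscription r, -1)"

definition hdb :: "symbol list \<Rightarrow> symbol" where
  "hdb r = (case r of [] \<Rightarrow> Blank | x # _ \<Rightarrow> x)"

lemma hdb_simps [simp]: "hdb [] = Blank" "hdb (x # r) = x"
  by (simp_all add: hdb_def)

lemma scan_mk [simp]: "scan (mk l r) = hdb r"
  by (cases r) (auto simp: scan_def mk_def inscription_def nth_append)

lemma scan_lft [simp]: "scan (lft r) = Blank"
  by (simp add: scan_def lft_def inscription_def)

lemma act_right [simp]: "act (mk l r) (b, Go_Right) = mk (b # l) (tl r)"
  by (cases r) (auto simp: act_def mk_def inscription_def fun_eq_iff nth_append nth_Cons' nat_less_iff)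

lemma act_stay: "act (mk l r) (b, Stay) = mk l (b # tl r)"
  by (cases r) (auto simp: act_def mk_def inscription_def fun_eq_iff nth_append nth_Cons' nat_less_iff)

lemma act_left: "act (mk (a # l) r) (b, Go_Left) = mk l (a # b # tl r)"
  by (cases r) (auto simp: act_def mk_def inscription_def fun_eq_iff nth_append nth_Cons' nat_less_iff)

text \<open>When the scanned symbol is written back, \<open>r\<close> can be kept literally even if
  it is empty, where \<open>act_left\<close> would produce a trailing \<open>Blank\<close>.\<close>

lemma act_left' [simp]: "act (mk (a # l) r) (hdb r, Go_Left) = mk l (a # r)"
  by (cases r) (auto simp: act_def mk_def inscription_def fun_eq_iff nth_append nth_Cons' nat_less_iff)

lemma act_left_Nil [simp]: "act (mk [] r) (hdb r, Go_Left) = lft r"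
  by (cases r) (auto simp: act_def lft_def mk_def inscription_def fun_eq_iff nth_append nth_Cons' nat_less_iff)

lemma act_lft [simp]: "act (lft r) (Blank, Go_Right) = mk [] r"
  by (auto simp: act_def lft_def mk_def inscription_def fun_eq_iff)

section \<open>Elementary commands, and moving, copying and erasing along a tape\<close>

definition put :: "nat \<Rightarrow> symbol \<Rightarrow> move \<Rightarrow> cmd" where
  "put i s m = Act (\<lambda>h. (idle h)(i := (s, m)))"

definition go :: "nat \<Rightarrow> move \<Rightarrow> cmd" where
  "go i m = Act (\<lambda>h. (idle h)(i := (h i, m)))"

definition cp :: "nat \<Rightarrow> nat \<Rightarrow> cmd" where
  "cp i j = Act (\<lambda>h. (idle h)(i := (h i, Go_Right), j := (h i, Go_Right)))"

definition go2 :: "nat \<Rightarrow> nat \<Rightarrow> move \<Rightarrow> cmd" where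
  "go2 i j m = Act (\<lambda>h. (idle h)(i := (h i, m), j := (h j, m)))"

lemma act_idle_upd: "act (T j) (idle (scan \<circ> T) j) = T j"
  by (simp add: idle_def)

lemma runs_put: "1 \<le> n \<Longrightarrow> T' = T(i := act (T i) (s, m)) \<Longrightarrow> runs (put i s m) T n T'"
  unfolding put_def by (rule runs_Act) (auto simp: act_idle_upd fun_eq_iff)

lemma runs_go: "1 \<le> n \<Longrightarrow> T' = T(i := act (T i) (scan (T i), m)) \<Longrightarrow> runs (go i m) T n T'"
  unfolding go_def by (rule runs_Act) (auto simp: act_idle_upd fun_eq_iff)

lemma runs_cp: "1 \<le> n \<Longrightarrow> i \<noteq> j \<Longrightarrow>
    T' = T(i := act (T i) (scan (T i), Go_Right), j := act (T j) (scan (T i), Go_Right)) \<Longrightarrow>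
    runs (cp i j) T n T'"
  unfolding cp_def by (rule runs_Act) (auto simp: act_idle_upd fun_eq_iff)

lemma runs_go2: "1 \<le> n \<Longrightarrow> i \<noteq> j \<Longrightarrow>
    T' = T(i := act (T i) (scan (T i), m), j := act (T j) (scan (T j), m)) \<Longrightarrow>
    runs (go2 i j m) T n T'"
  unfolding go2_def by (rule runs_Act) (auto simp: act_idle_upd fun_eq_iff)

lemma wf_basic [simp]:
  "i < K \<Longrightarrow> s \<in> A \<Longrightarrow> wf_cmd K A (put i s m)"
  "i < K \<Longrightarrow> wf_cmd K A (go i m)"
  "i < K \<Longrightarrow> j < K \<Longrightarrow> wf_cmd K A (cp i j)"
  "i < K \<Longrightarrow> j < K \<Longrightarrow> wf_cmd K A (go2 i j m)"
  by (auto simp: put_def go_def cp_def go2_def local_on_def idle_def)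

definition skip_to :: "nat \<Rightarrow> symbol set \<Rightarrow> cmd" where
  "skip_to i X = Loop (\<lambda>h. h i \<notin> X) (go i Go_Right)"

definition copy_to :: "nat \<Rightarrow> nat \<Rightarrow> symbol set \<Rightarrow> cmd" where
  "copy_to i j X = Loop (\<lambda>h. h i \<notin> X) (cp i j)"

text \<open>The first move precedes any test because the head may itself stand on a symbol of
  \<open>X\<close>, such as the \<open>Blank\<close> behind the contents. The loop halts on the
  delimiter, or on the blank cell -1, so one step to the right reaches the first symbol after
  it.\<close>

definition back_to :: "nat \<Rightarrow> symbol set \<Rightarrow> cmd" where
  "back_to i X = (go i Go_Left ;; Loop (\<lambda>h. h i \<notin> X) (go i Go_Left) ;; go i Go_Right)"

text \<open>Tapes have to be emptied before reuse, since \<open>runs_copy_to\<close> demands a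
  target with nothing under or to the right of its head.\<close>

definition erase :: "nat \<Rightarrow> cmd" where
  "erase i = (go i Go_Left ;; Loop (\<lambda>h. h i \<noteq> Blank) (put i Blank Go_Left) ;; go i Go_Right)"

lemma wf_subroutines [simp]:
  "i < K \<Longrightarrow> wf_cmd K A (skip_to i X)"
  "i < K \<Longrightarrow> j < K \<Longrightarrow> wf_cmd K A (copy_to i j X)"
  "i < K \<Longrightarrow> wf_cmd K A (back_to i X)"
  "i < K \<Longrightarrow> Blank \<in> A \<Longrightarrow> wf_cmd K A (erase i)"
  by (auto simp: skip_to_def copy_to_def back_to_def erase_def local_on_def)

lemma runs_skip_to:
  assumes "T i = mk l (xs @ r)" "set xs \<inter> X = {}" "hdb r \<in> X" "2 * length xs + 1 \<le> n"
    "T' = T(i := mk (rev xs @ l) r)"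
  shows "runs (skip_to i X) T n T'"
  using assms
proof (induction xs arbitrary: T l n)
  case Nil
  then show ?case
    unfolding skip_to_def by (intro runs_Loop_exit) auto
next
  case (Cons x xs)
  have "runs (Loop (\<lambda>h. h i \<notin> X) (go i Go_Right)) (T(i := mk (x # l) (xs @ r))) (n - 2) T'"
    unfolding skip_to_def[symmetric] by (rule Cons.IH) (use Cons.prems in auto)
  then show ?case
    unfolding skip_to_def
    by (rule runs_Loop_enter[where m = 1, rotated 2]) (use Cons.prems in \<open>auto intro!: runs_go\<close>)
qed

lemma runs_copy_to:
  assumes "T i = mk l (xs @ r)" "T j = mk l' []" "i \<noteq> j" "set xs \<inter> X = {}" "hdb r \<in> X"
    "2 * length xs + 1 \<le> n" "T' = T(i := mk (rev xs @ l) r, j := mk (rev xs @ l') [])"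
  shows "runs (copy_to i j X) T n T'"
  using assms
proof (induction xs arbitrary: T l l' n)
  case Nil
  then show ?case
    unfolding copy_to_def by (intro runs_Loop_exit) auto
next
  case (Cons x xs)
  have "runs (Loop (\<lambda>h. h i \<notin> X) (cp i j)) (T(i := mk (x # l) (xs @ r), j := mk (x # l') [])) (n - 2) T'"
    unfolding copy_to_def[symmetric] by (rule Cons.IH) (use Cons.prems in \<open>auto simp: fun_eq_iff\<close>)
  then show ?case
    unfolding copy_to_def
    by (rule runs_Loop_enter[where m = 1, rotated 2]) (use Cons.prems in \<open>auto intro!: runs_cp\<close>)
qed

text \<open>No symbol up to the origin stops the head, so it comes to rest on cell -1, which is
  blank. Each of the \<open>length l + 1\<close> symbols costs a test and a move, and one more test
  ends the loop.\<close>

lemma runs_left_loop: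
  assumes "T i = mk l (x # r)" "set (x # l) \<inter> X = {}" "Blank \<in> X"
    "2 * length l + 3 \<le> n" "T' = T(i := lft (rev l @ x # r))"
  shows "runs (Loop (\<lambda>h. h i \<notin> X) (go i Go_Left)) T n T'"
  using assms
proof (induction l arbitrary: T x r n)
  case Nil
  have "runs (Loop (\<lambda>h. h i \<notin> X) (go i Go_Left)) T' 1 T'"
    using Nil by (intro runs_Loop_exit) auto
  then show ?case
    by (rule runs_Loop_enter[where m = 1, rotated 2])
      (use Nil act_left_Nil[of "x # r"] in \<open>auto intro!: runs_go\<close>)
next
  case (Cons y l)
  have "runs (Loop (\<lambda>h. h i \<notin> X) (go i Go_Left)) (T(i := mk l (y # x # r))) (n - 2) T'"
    by (rule Cons.IH) (use Cons.prems in auto)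
  then show ?case
    by (rule runs_Loop_enter[where m = 1, rotated 2])
      (use Cons.prems act_left'[of y l "x # r"] in \<open>auto intro!: runs_go\<close>)
qed

lemma runs_left_loop_stop:
  assumes "T i = mk (l @ s # l') (x # r)" "set (x # l) \<inter> X = {}" "s \<in> X"
    "2 * length l + 3 \<le> n" "T' = T(i := mk l' (s # rev l @ x # r))"
  shows "runs (Loop (\<lambda>h. h i \<notin> X) (go i Go_Left)) T n T'"
  using assms
proof (induction l arbitrary: T x r n)
  case Nil
  have "runs (Loop (\<lambda>h. h i \<notin> X) (go i Go_Left)) T' 1 T'"
    using Nil by (intro runs_Loop_exit) auto
  then show ?case
    by (rule runs_Loop_enter[where m = 1, rotated 2])
      (use Nil act_left'[of s l' "x # r"] in \<open>auto intro!: runs_go\<close>)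
next
  case (Cons y l)
  have "runs (Loop (\<lambda>h. h i \<notin> X) (go i Go_Left)) (T(i := mk (l @ s # l') (y # x # r))) (n - 2) T'"
    by (rule Cons.IH) (use Cons.prems in auto)
  then show ?case
    by (rule runs_Loop_enter[where m = 1, rotated 2])
      (use Cons.prems act_left'[of y "l @ s # l'" "x # r"] in \<open>auto intro!: runs_go\<close>)
qed

lemma runs_back_to:
  assumes "T i = mk l r" "set l \<inter> X = {}" "Blank \<in> X" "2 * length l + 5 \<le> n"
    "T' = T(i := mk [] (rev l @ r))"
  shows "runs (back_to i X) T n T'"
proof (cases l)
  case Nil
  show ?thesis
    unfolding back_to_def
    apply (rule runs_Seq[where m = 1 and n = 3 and T' = "T(i := lft r)"])
      apply (rule runs_go; use assms Nil in simp)
     apply (rule runs_Seq[where m = 1 and n = 1 and T' = "T(i := lft r)"])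
       apply (rule runs_Loop_exit; use assms in simp)
      apply (rule runs_go; use assms Nil in simp)
    using assms by auto
next
  case (Cons x l')
  show ?thesis
    unfolding back_to_def
    apply (rule runs_Seq[where m = 1 and n = "2 * length l' + 5" and T' = "T(i := mk l' (x # r))"])
      apply (rule runs_go; use assms Cons in simp)
     apply (rule runs_Seq[where m = "2 * length l' + 3" and n = 1 and T' = "T(i := lft (rev l @ r))"])
       apply (rule runs_left_loop[where l = l' and x = x and r = r]; use assms Cons in auto)
      apply (rule runs_go; use assms Cons in simp)
    using assms Cons by auto
qed

lemma runs_back_to_stop:
  assumes "T i = mk (l @ s # l') r" "set l \<inter> X = {}" "s \<in> X" "2 * length l + 5 \<le> n"
    "T' = T(i := mk (s # l') (rev l @ r))"
  shows "runs (back_to i X) T n T'"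
proof (cases l)
  case Nil
  show ?thesis
    unfolding back_to_def
    apply (rule runs_Seq[where m = 1 and n = 3 and T' = "T(i := mk l' (s # r))"])
      apply (rule runs_go; use assms Nil in simp)
     apply (rule runs_Seq[where m = 1 and n = 1 and T' = "T(i := mk l' (s # r))"])
       apply (rule runs_Loop_exit; use assms in simp)
      apply (rule runs_go; use assms Nil in simp)
    using assms by auto
next
  case (Cons x m)
  show ?thesis
    unfolding back_to_def
    apply (rule runs_Seq[where m = 1 and n = "2 * length m + 5" and T' = "T(i := mk (m @ s # l') (x # r))"])
      apply (rule runs_go; use assms Cons in simp)
     apply (rule runs_Seq[where m = "2 * length m + 3" and n = 1 and T' = "T(i := mk l' (s # rev l @ r))"])
       apply (rule runs_left_loop_stop[where l = m and x = x and r = r]; use assms Cons in auto)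
      apply (rule runs_go; use assms Cons in simp)
    using assms Cons by auto
qed

text \<open>A tape does not remember how far it has been written; hence erasing leads back to
  \<open>[]\<close> and not to a list of blanks.\<close>

lemma mk_append_Blanks: "mk l (xs @ replicate n Blank) = mk l xs"
  by (auto simp: mk_def inscription_def fun_eq_iff nth_append)

lemma runs_erase_loop:
  assumes "T i = mk l [x]" "Blank \<notin> set (x # l)" "2 * length l + 3 \<le> n" "T' = T(i := lft [])"
  shows "runs (Loop (\<lambda>h. h i \<noteq> Blank) (put i Blank Go_Left)) T n T'"
  using assms
proof (induction l arbitrary: T x n)
  case Nil
  have eq: "act (mk [] [x]) (Blank, Go_Left) = lft []"
    by (auto simp: act_def mk_def lft_def inscription_def fun_eq_iff)
  have "runs (Loop (\<lambda>h. h i \<noteq> Blank) (put i Blank Go_Left)) T' 1 T'"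
    using Nil by (intro runs_Loop_exit) auto
  then show ?case
    by (rule runs_Loop_enter[where m = 1, rotated 2]) (use Nil eq in \<open>auto intro!: runs_put\<close>)
next
  case (Cons y l)
  have eq: "act (mk (y # l) [x]) (Blank, Go_Left) = mk l [y]"
    using mk_append_Blanks[of l "[y]" 1] by (simp add: act_left)
  have "runs (Loop (\<lambda>h. h i \<noteq> Blank) (put i Blank Go_Left)) (T(i := mk l [y])) (n - 2) T'"
    by (rule Cons.IH) (use Cons.prems in auto)
  then show ?case
    by (rule runs_Loop_enter[where m = 1, rotated 2])
      (use Cons.prems eq in \<open>auto intro!: runs_put\<close>)
qed

lemma runs_erase:
  assumes "T i = mk l []" "Blank \<notin> set l" "2 * length l + 5 \<le> n" "T' = T(i := mk [] [])"
  shows "runs (erase i) T n T'"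
proof (cases l)
  case Nil
  show ?thesis
    unfolding erase_def
    apply (rule runs_Seq[where m = 1 and n = 3 and T' = "T(i := lft [])"])
      apply (rule runs_go; use assms Nil act_left_Nil[of "[]"] in simp)
     apply (rule runs_Seq[where m = 1 and n = 1 and T' = "T(i := lft [])"])
       apply (rule runs_Loop_exit; use assms in simp)
      apply (rule runs_go; use assms Nil in simp)
    using assms by auto
next
  case (Cons x l')
  show ?thesis
    unfolding erase_def
    apply (rule runs_Seq[where m = 1 and n = "2 * length l' + 5" and T' = "T(i := mk l' [x])"])
      apply (rule runs_go; use assms Cons act_left'[of x l' "[]"] in simp)
     apply (rule runs_Seq[where m = "2 * length l' + 3" and n = 1 and T' = "T(i := lft [])"])
       apply (rule runs_erase_loop[where l = l' and x = x]; use assms Cons in auto)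
      apply (rule runs_go; use assms Cons in simp)
    using assms Cons by auto
qed

section \<open>Insertion sort\<close>

lemma runs_put_end:
  "T i = mk l [] \<Longrightarrow> T' = T(i := mk (s # l) []) \<Longrightarrow> runs (put i s Go_Right) T 1 T'"
  by (rule runs_put) auto

lemma runs_go_right:
  "T i = mk l (x # r) \<Longrightarrow> T' = T(i := mk (x # l) r) \<Longrightarrow> runs (go i Go_Right) T 1 T'"
  by (rule runs_go) auto

text \<open>The reflexive closure of \<open>lex_less\<close>, in the recursive form that follows two
  heads reading both strings letter by letter.\<close>

fun leq :: "bool list \<Rightarrow> bool list \<Rightarrow> bool" where
  "leq [] y \<longleftrightarrow> True"
| "leq (a # x) [] \<longleftrightarrow> False"
| "leq (a # x) (b # y) \<longleftrightarrow> (if a = b then leq x y else b)"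

definition lo :: "bool list \<Rightarrow> bool list \<Rightarrow> bool list" where
  "lo x y = (if leq x y then x else y)"

definition hi :: "bool list \<Rightarrow> bool list \<Rightarrow> bool list" where
  "hi x y = (if leq x y then y else x)"

text \<open>Insertion as a bubble pass: a string is carried along the list, at each entry the
  smaller of the two is output and the larger is carried on. Thus no position for the insertion has
  to be found. \<open>low\<close> is the output of the pass, \<open>topmost\<close> the string still
  carried at its end.\<close>

fun low :: "bool list \<Rightarrow> bool list list \<Rightarrow> bool list list" where
  "low x [] = []"
| "low x (y # ys) = lo x y # low (hi x y) ys"

fun topmost :: "bool list \<Rightarrow> bool list list \<Rightarrow> bool list" where
  "topmost x [] = x"
| "topmost x (y # ys) = topmost (hi x y) ys"

definition ins :: "bool list \<Rightarrow> bool list list \<Rightarrow> bool list list" where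
  "ins x ys = low x ys @ [topmost x ys]"

lemma leq_append: "leq (p @ x) (p @ y) = leq x y"
  by (induction p) auto

section \<open>Encoded tuples, comparison of fields, and one step of a bubble pass\<close>

lemma enc_tuple_simps [simp]:
  "enc_tuple [] = []" "enc_tuple (z # zs) = enc_string z @ Sep # enc_tuple zs"
  "enc_tuple (xs @ ys) = enc_tuple xs @ enc_tuple ys"
  by (simp_all add: enc_tuple_def)

lemma length_enc_string [simp]: "length (enc_string z) = length z"
  by (simp add: enc_string_def)

lemma set_enc_string: "set (enc_string z) \<subseteq> range Bit"
  by (auto simp: enc_string_def)

lemma set_enc_tuple: "set (enc_tuple zs) \<subseteq> insert Sep (range Bit)"
proof (induction zs)
  case (Cons z zs)
  then show ?case
    using set_enc_string[of z] by auto
qed simp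

lemma not_in_enc [simp]:
  "Blank \<notin> set (enc_string z)" "Sep \<notin> set (enc_string z)" "Blank \<notin> set (enc_tuple zs)"
  using set_enc_string[of z] set_enc_tuple[of zs] by auto

text \<open>Describes where two heads advancing in lockstep stop: one string is exhausted, or the
  next letters differ.\<close>

lemma common_prefix:
  fixes x y :: "bool list"
  obtains p x' y' where "x = p @ x'" "y = p @ y'" "x' = [] \<or> y' = [] \<or> hd x' \<noteq> hd y'"
proof -
  have "\<exists>p x' y'. x = p @ x' \<and> y = p @ y' \<and> (x' = [] \<or> y' = [] \<or> hd x' \<noteq> hd y')"
  proof (induction x y rule: leq.induct)
    case (3 a x b y)
    show ?case
    proof (cases "a = b")
      case True
      then obtain p x' y' where "x = p @ x' \<and> y = p @ y' \<and> (x' = [] \<or> y' = [] \<or> hd x' \<noteq> hd y')"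
        using 3 by blast
      then show ?thesis
        using True by (intro exI[of _ "a # p"] exI[of _ x'] exI[of _ y']) simp
    next
      case False
      then show ?thesis
        by (intro exI[of _ "[]"] exI[of _ "a # x"] exI[of _ "b # y"]) simp
    qed
  qed auto
  then show ?thesis
    using that by blast
qed

text \<open>No test for an end is made: wherever the loop is used, one string is followed by
  \<open>Sep\<close> and the other by \<open>Blank\<close>, so the heads see different symbols even
  after equal strings.\<close>

definition match_loop :: "nat \<Rightarrow> nat \<Rightarrow> cmd" where
  "match_loop i j = Loop (\<lambda>h. h i = h j) (go2 i j Go_Right)"

lemma runs_match_loop:
  assumes "T i = mk l (p @ r)" "T j = mk l' (p @ r')" "i \<noteq> j" "hdb r \<noteq> hdb r'"
    "2 * length p + 1 \<le> n" "T' = T(i := mk (rev p @ l) r, j := mk (rev p @ l') r')"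
  shows "runs (match_loop i j) T n T'"
  using assms
proof (induction p arbitrary: T l l' n)
  case Nil
  then show ?case
    unfolding match_loop_def by (intro runs_Loop_exit) (auto simp: fun_eq_iff)
next
  case (Cons x p)
  have "runs (match_loop i j) (T(i := mk (x # l) (p @ r), j := mk (x # l') (p @ r'))) (n - 2) T'"
    by (rule Cons.IH) (use Cons.prems in \<open>auto simp: fun_eq_iff\<close>)
  then show ?case
    unfolding match_loop_def
    by (rule runs_Loop_enter[where m = 1, rotated 2]) (use Cons.prems in \<open>auto intro!: runs_go2\<close>)
qed

text \<open>The first field of a tuple is bounded on the left by cell -1, any other by the
  \<open>Sep\<close> of its predecessor; \<open>m\<close> covers both.\<close>

lemma runs_back_to_field:
  assumes "T i = mk (rev (enc_string p) @ m) r" "m = [] \<or> hd m = Sep" "2 * length p + 5 \<le> n"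
    "T' = T(i := mk m (enc_string p @ r))"
  shows "runs (back_to i {Blank, Sep}) T n T'"
proof (cases m)
  case Nil
  then show ?thesis
    using assms by (intro runs_back_to[of T i "rev (enc_string p)" r]) auto
next
  case (Cons s m')
  then show ?thesis
    using assms by (intro runs_back_to_stop[of T i "rev (enc_string p)" s m' r]) auto
qed

lemma runs_back_to_start:
  assumes "T i = mk l r" "Blank \<notin> set l" "2 * length l + 5 \<le> n" "T' = T(i := mk [] (rev l @ r))"
  shows "runs (back_to i {Blank}) T n T'"
  using assms by (intro runs_back_to) auto

text \<open>Tapes: 0 input and output, 1 the state of the simulated machine \<open>M\<close>, 2 the log of its head
  moves, 3 the input tuple, 4 the current string, 5 scratch space for sorting, 6 the strings already
  answered, 7 the current answer, and from 8 on the tapes of \<open>M\<close>. The sorted tuple is built on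
  tape 8.\<close>

abbreviation st :: "store \<Rightarrow> tape \<Rightarrow> tape \<Rightarrow> tape \<Rightarrow> tape \<Rightarrow> store" where
  "st R z c s b \<equiv> R(3 := z, 4 := c, 5 := s, 8 := b)"

text \<open>The test decides \<open>leq\<close> at the first disagreement: tape 4 shows
  \<open>Blank\<close> exactly if the carried string is a prefix of the entry, and otherwise the
  carried string is smaller only with \<open>Bit False\<close> against \<open>Bit True\<close>. In
  the first branch the entry replaces the carried string on tape 4.\<close>

definition bubble :: cmd where
  "bubble =
     (match_loop 4 8 ;;
      Branch (\<lambda>h. h 4 = Blank \<or> h 4 = Bit False \<and> h 8 = Bit True)
        (back_to 4 {Blank} ;; back_to 8 {Blank, Sep} ;; copy_to 4 5 {Blank} ;;
         put 5 Sep Go_Right ;; erase 4 ;; copy_to 8 4 {Sep} ;; go 8 Go_Right ;; back_to 4 {Blank})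
        (back_to 4 {Blank} ;; back_to 8 {Blank, Sep} ;; copy_to 8 5 {Sep} ;;
         put 5 Sep Go_Right ;; go 8 Go_Right))"

text \<open>The first branch is the longer one: with the comparison it makes seven passes over at
  most \<open>N\<close> symbols, each of cost \<open>2 * N\<close> plus a constant. The bound is
  rounded up.\<close>

lemma runs_bubble:
  assumes m: "m = [] \<or> hd m = Sep" and N: "length x \<le> N" "length y \<le> N"
  shows "runs bubble (st R z (mk [] (enc_string x)) (mk l []) (mk m (enc_string y @ Sep # r)))
    (20 * N + 40)
    (st R z (mk [] (enc_string (hi x y))) (mk (Sep # rev (enc_string (lo x y)) @ l) [])
       (mk (Sep # rev (enc_string y) @ m) r))"
proof -
  obtain p x' y' where p: "x = p @ x'" "y = p @ y'" "x' = [] \<or> y' = [] \<or> hd x' \<noteq> hd y'"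
    by (rule common_prefix)
  let ?T1 = "st R z (mk (rev (enc_string p)) (enc_string x')) (mk l [])
    (mk (rev (enc_string p) @ m) (enc_string y' @ Sep # r))"
  let ?S = "st R z"
  let ?test = "hdb (enc_string x') = Blank \<or>
    hdb (enc_string x') = Bit False \<and> hdb (enc_string y' @ Sep # r) = Bit True"
  have enc_app: "enc_string (u @ v) = enc_string u @ enc_string v" for u v
    by (simp add: enc_string_def)
  have len: "length p \<le> N"
    using N p by simp
  have differ: "hdb (enc_string x') \<noteq> hdb (enc_string y' @ Sep # r)"
    using p(3) by (cases x'; cases y') (auto simp: enc_string_def)
  have match: "runs (match_loop 4 8)
      (?S (mk [] (enc_string x)) (mk l []) (mk m (enc_string y @ Sep # r))) (2 * N + 1) ?T1"
    by (rule runs_match_loop[where p = "enc_string p" and l = "[]" and l' = m])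
      (use p len differ in \<open>auto simp: enc_app fun_eq_iff\<close>)
  have test: "?test \<longleftrightarrow> leq x y"
    unfolding p(1,2) leq_append using p(3) by (cases x'; cases y') (auto simp: enc_string_def)
  have rew4: "runs (back_to 4 {Blank}) ?T1 (2 * N + 5)
      (?S (mk [] (enc_string x)) (mk l []) (mk (rev (enc_string p) @ m) (enc_string y' @ Sep # r)))"
    by (rule runs_back_to_start[where l = "rev (enc_string p)"])
      (use p len in \<open>auto simp: enc_app fun_eq_iff\<close>)
  have rew8: "runs (back_to 8 {Blank, Sep})
      (?S (mk [] (enc_string x)) (mk l []) (mk (rev (enc_string p) @ m) (enc_string y' @ Sep # r)))
      (2 * N + 5) (?S (mk [] (enc_string x)) (mk l []) (mk m (enc_string y @ Sep # r)))"
    by (rule runs_back_to_field[OF _ m, where p = p]) (use p len in \<open>auto simp: enc_app fun_eq_iff\<close>)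
  show ?thesis
  proof (cases "leq x y")
    case True
    have 1: "runs (copy_to 4 5 {Blank})
      (?S (mk [] (enc_string x)) (mk l []) (mk m (enc_string y @ Sep # r))) (2 * N + 1)
      (?S (mk (rev (enc_string x)) []) (mk (rev (enc_string x) @ l) []) (mk m (enc_string y @ Sep # r)))"
      by (rule runs_copy_to[where xs = "enc_string x" and r = "[]" and l = "[]"])
        (use N in \<open>auto simp: fun_eq_iff\<close>)
    have 2: "runs (put 5 Sep Go_Right)
      (?S (mk (rev (enc_string x)) []) (mk (rev (enc_string x) @ l) []) (mk m (enc_string y @ Sep # r))) 1
      (?S (mk (rev (enc_string x)) []) (mk (Sep # rev (enc_string x) @ l) []) (mk m (enc_string y @ Sep # r)))"
      by (rule runs_put_end) (auto simp: fun_eq_iff)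
    have 3: "runs (erase 4)
      (?S (mk (rev (enc_string x)) []) (mk (Sep # rev (enc_string x) @ l) []) (mk m (enc_string y @ Sep # r)))
      (2 * N + 5)
      (?S (mk [] []) (mk (Sep # rev (enc_string x) @ l) []) (mk m (enc_string y @ Sep # r)))"
      by (rule runs_erase[where l = "rev (enc_string x)"]) (use N in \<open>auto simp: fun_eq_iff\<close>)
    have 4: "runs (copy_to 8 4 {Sep})
      (?S (mk [] []) (mk (Sep # rev (enc_string x) @ l) []) (mk m (enc_string y @ Sep # r)))
      (2 * N + 1)
      (?S (mk (rev (enc_string y)) []) (mk (Sep # rev (enc_string x) @ l) []) (mk (rev (enc_string y) @ m) (Sep # r)))"
      by (rule runs_copy_to[where xs = "enc_string y" and r = "Sep # r" and l = m and l' = "[]"])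
        (use N in \<open>auto simp: fun_eq_iff\<close>)
    have 5: "runs (go 8 Go_Right)
      (?S (mk (rev (enc_string y)) []) (mk (Sep # rev (enc_string x) @ l) []) (mk (rev (enc_string y) @ m) (Sep # r))) 1
      (?S (mk (rev (enc_string y)) []) (mk (Sep # rev (enc_string x) @ l) []) (mk (Sep # rev (enc_string y) @ m) r))"
      by (rule runs_go_right) (auto simp: fun_eq_iff)
    have 6: "runs (back_to 4 {Blank})
      (?S (mk (rev (enc_string y)) []) (mk (Sep # rev (enc_string x) @ l) []) (mk (Sep # rev (enc_string y) @ m) r))
      (2 * N + 5)
      (?S (mk [] (enc_string y)) (mk (Sep # rev (enc_string x) @ l) []) (mk (Sep # rev (enc_string y) @ m) r))"
      by (rule runs_back_to_start[where l = "rev (enc_string y)" and r = "[]"]) (use N in \<open>auto simp: fun_eq_iff\<close>)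
    show ?thesis
      unfolding bubble_def hi_def lo_def if_P[OF True]
      by (rule runs_Seq[OF match runs_Branch_True[OF _ runs_Seq[OF rew4 runs_Seq[OF rew8 runs_Seq[OF 1
            runs_Seq[OF 2 runs_Seq[OF 3 runs_Seq[OF 4 runs_Seq[OF 5 6
            order_refl] order_refl] order_refl] order_refl] order_refl] order_refl] order_refl] order_refl]])
        (use True test in simp_all)
  next
    case False
    have 1: "runs (copy_to 8 5 {Sep})
      (?S (mk [] (enc_string x)) (mk l []) (mk m (enc_string y @ Sep # r))) (2 * N + 1)
      (?S (mk [] (enc_string x)) (mk (rev (enc_string y) @ l) []) (mk (rev (enc_string y) @ m) (Sep # r)))"
      by (rule runs_copy_to[where xs = "enc_string y" and r = "Sep # r" and l = m])
        (use N in \<open>auto simp: fun_eq_iff\<close>)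
    have 2: "runs (put 5 Sep Go_Right)
      (?S (mk [] (enc_string x)) (mk (rev (enc_string y) @ l) []) (mk (rev (enc_string y) @ m) (Sep # r))) 1
      (?S (mk [] (enc_string x)) (mk (Sep # rev (enc_string y) @ l) []) (mk (rev (enc_string y) @ m) (Sep # r)))"
      by (rule runs_put_end) (auto simp: fun_eq_iff)
    have 3: "runs (go 8 Go_Right)
      (?S (mk [] (enc_string x)) (mk (Sep # rev (enc_string y) @ l) []) (mk (rev (enc_string y) @ m) (Sep # r))) 1
      (?S (mk [] (enc_string x)) (mk (Sep # rev (enc_string y) @ l) []) (mk (Sep # rev (enc_string y) @ m) r))"
      by (rule runs_go_right) (auto simp: fun_eq_iff)
    show ?thesis
      unfolding bubble_def hi_def lo_def if_not_P[OF False]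
      by (rule runs_Seq[OF match runs_Branch_False[OF _ runs_Seq[OF rew4 runs_Seq[OF rew8 runs_Seq[OF 1
            runs_Seq[OF 2 3 order_refl] order_refl] order_refl] order_refl] order_refl]])
        (use False test in simp_all)
  qed
qed

section \<open>Insertion sort on lists\<close>

lemma ins_simps [simp]: "ins x [] = [x]" "ins x (y # ys) = lo x y # ins (hi x y) ys"
  by (simp_all add: ins_def)

lemma set_ins: "set (ins x ys) = insert x (set ys)"
  by (induction ys arbitrary: x) (auto simp: lo_def hi_def)

lemma length_ins: "length (ins x ys) = Suc (length ys)"
  by (induction ys arbitrary: x) auto

lemma length_enc_ins: "length (enc_tuple (ins x ys)) = Suc (length x + length (enc_tuple ys))"
  by (induction ys arbitrary: x) (auto simp: lo_def hi_def)

lemma leq_linear: "leq x y \<or> leq y x"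
  by (induction x y rule: leq.induct) auto

lemma leq_refl: "leq x x"
  by (induction x) auto

lemma leq_trans: "leq x y \<Longrightarrow> leq y z \<Longrightarrow> leq x z"
proof (induction x y arbitrary: z rule: leq.induct)
  case (3 a x b y)
  then show ?case
    by (cases z) (auto split: if_splits)
qed auto

lemma leq_lex_less: "leq x y \<Longrightarrow> x \<noteq> y \<Longrightarrow> lex_less x y"
proof (induction x y rule: leq.induct)
  case (1 y)
  then show ?case
    by (cases y) (auto simp: lex_less_def)
next
  case (3 a x b y)
  then show ?case
    by (auto simp: lex_less_def split: if_splits)
qed auto

lemma lo_hi: "leq (lo x y) (hi x y)" "leq (lo x y) y"
  using leq_linear[of x y] leq_refl by (auto simp: lo_def hi_def)

text \<open>\<open>lo x y\<close> is below \<open>hi x y\<close> and below \<open>y\<close>, and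
  \<open>y\<close> is below all later entries; so the first string output is below everything that
  follows.\<close>

lemma sorted_ins: "sorted_wrt leq ys \<Longrightarrow> sorted_wrt leq (ins x ys)"
proof (induction ys arbitrary: x)
  case (Cons y ys)
  then show ?case
    using lo_hi[of x y] leq_trans[of "lo x y" y] by (auto simp: set_ins)
qed simp

definition isort :: "bool list list \<Rightarrow> bool list list" where
  "isort zs = fold ins zs []"

lemma set_isort: "set (isort zs) = set zs"
proof -
  have "set (fold ins zs ys) = set zs \<union> set ys" for ys
    by (induction zs arbitrary: ys) (auto simp: set_ins)
  then show ?thesis
    by (simp add: isort_def)
qed

lemma length_isort: "length (isort zs) = length zs"
proof -
  have "length (fold ins zs ys) = length zs + length ys" for ys
    by (induction zs arbitrary: ys) (auto simp: length_ins)
  then show ?thesis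
    by (simp add: isort_def)
qed

text \<open>Allows the time bound of the simulated machine, which runs on the sorted tuple, to be
  evaluated at the length of the original input.\<close>

lemma length_enc_isort: "length (enc_tuple (isort zs)) = length (enc_tuple zs)"
proof -
  have "length (enc_tuple (fold ins zs ys)) = length (enc_tuple zs) + length (enc_tuple ys)" for ys
    by (induction zs arbitrary: ys) (auto simp: length_enc_ins)
  then show ?thesis
    by (simp add: isort_def)
qed

text \<open>Sorting keeps the set and the number of strings, hence distinctness by counting; between
  distinct strings \<open>leq\<close> is strict.\<close>

lemma sorted_isort:
  assumes "distinct zs"
  shows "sorted_wrt lex_less (isort zs)"
proof -
  have "sorted_wrt leq (fold ins zs ys)" if "sorted_wrt leq ys" for ys
    using that by (induction zs arbitrary: ys) (auto simp: sorted_ins)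
  then have "sorted_wrt leq (isort zs)"
    by (simp add: isort_def)
  moreover have "distinct (isort zs)"
    using assms by (intro card_distinct) (simp add: set_isort length_isort distinct_card)
  ultimately show ?thesis
    by (auto simp: sorted_wrt_iff_nth_less nth_eq_iff_index_eq intro!: leq_lex_less)
qed

lemma length_le_enc_tuple: "length zs \<le> length (enc_tuple zs)"
  by (induction zs) auto

lemma length_field_le: "z \<in> set zs \<Longrightarrow> Suc (length z) \<le> length (enc_tuple zs)"
  by (induction zs) auto

text \<open>Even an empty string contributes its \<open>Sep\<close>, so a \<open>Blank\<close> at
  the start of a field reliably marks the end of the tuple. The loops over fields test for
  it.\<close>

lemma hdb_enc_tuple: "hdb (enc_tuple zs) = Blank \<longleftrightarrow> zs = []"
proof (cases zs)
  case (Cons z zs')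
  then show ?thesis
    by (cases z) (auto simp: enc_string_def)
qed simp

lemma length_hi: "length x \<le> N \<Longrightarrow> length y \<le> N \<Longrightarrow> length (hi x y) \<le> N"
  by (simp add: hi_def)

section \<open>The sorting program\<close>

lemma runs_bubbles:
  assumes "m = [] \<or> hd m = Sep" "length x \<le> N" "\<forall>y \<in> set ys. length y \<le> N"
  shows "runs (Loop (\<lambda>h. h 8 \<noteq> Blank) bubble)
    (st R z (mk [] (enc_string x)) (mk l []) (mk m (enc_tuple ys)))
    (length ys * (20 * N + 41) + 1)
    (st R z (mk [] (enc_string (topmost x ys))) (mk (rev (enc_tuple (low x ys)) @ l) [])
       (mk (rev (enc_tuple ys) @ m) []))"
  using assms
proof (induction ys arbitrary: x l m)
  case Nil
  then show ?case
    by (intro runs_Loop_exit) auto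
next
  case (Cons y ys)
  have step: "runs bubble
      (st R z (mk [] (enc_string x)) (mk l []) (mk m (enc_string y @ Sep # enc_tuple ys))) (20 * N + 40)
      (st R z (mk [] (enc_string (hi x y))) (mk (Sep # rev (enc_string (lo x y)) @ l) [])
        (mk (Sep # rev (enc_string y) @ m) (enc_tuple ys)))"
    using Cons.prems by (intro runs_bubble) auto
  have rest: "runs (Loop (\<lambda>h. h 8 \<noteq> Blank) bubble)
      (st R z (mk [] (enc_string (hi x y))) (mk (Sep # rev (enc_string (lo x y)) @ l) [])
        (mk (Sep # rev (enc_string y) @ m) (enc_tuple ys)))
      (length ys * (20 * N + 41) + 1)
      (st R z (mk [] (enc_string (topmost x (y # ys)))) (mk (rev (enc_tuple (low x (y # ys))) @ l) [])
        (mk (rev (enc_tuple (y # ys)) @ m) []))"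
    using Cons.IH[of "Sep # rev (enc_string y) @ m" "hi x y" "Sep # rev (enc_string (lo x y)) @ l"] Cons.prems
    by (simp add: length_hi del: fun_upd_apply)
  have ne: "hdb (enc_tuple (y # ys)) \<noteq> Blank"
    unfolding hdb_enc_tuple by simp
  show ?case
    by (rule runs_Loop_enter[OF _ step[folded enc_tuple_simps(2)] rest]) (use ne in simp_all)
qed

text \<open>The pass leaves the new list on tape 5, lacking the string still carried on tape 4. Once
  completed, the list replaces the old one on tape 8, and tapes 4 and 5 are emptied so that the next
  insertion starts from a store of the same form.\<close>

definition insert_field :: cmd where
  "insert_field =
     (copy_to 3 4 {Sep} ;; go 3 Go_Right ;; back_to 4 {Blank} ;;
      Loop (\<lambda>h. h 8 \<noteq> Blank) bubble ;;
      copy_to 4 5 {Blank} ;; put 5 Sep Go_Right ;; erase 4 ;; erase 8 ;; back_to 5 {Blank} ;;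
      copy_to 5 8 {Blank} ;; erase 5 ;; back_to 8 {Blank})"

lemma runs_insert_field:
  assumes N: "Suc (length z + length (enc_tuple ys)) \<le> N"
  shows "runs insert_field
    (st R (mk l (enc_string z @ Sep # r)) (mk [] []) (mk [] []) (mk [] (enc_tuple ys)))
    (20 * N * N + 60 * N + 60)
    (st R (mk (Sep # rev (enc_string z) @ l) r) (mk [] []) (mk [] []) (mk [] (enc_tuple (ins z ys))))"
proof -
  let ?S = "st R"
  let ?e = "mk [] []"
  let ?l = "Sep # rev (enc_string z) @ l"
  let ?t = "enc_string (topmost z ys)"
  let ?u = "enc_tuple (ins z ys)"
  have u: "?u = enc_tuple (low z ys) @ ?t @ [Sep]"
    by (simp add: ins_def)
  have lu: "length ?u \<le> N"
    using N by (simp add: length_enc_ins)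
  have lt: "length (topmost z ys) \<le> N"
    using lu u by simp
  have lys: "length (enc_tuple ys) \<le> N" "length ys \<le> N" "length z \<le> N"
    using N length_le_enc_tuple[of ys] by auto
  have fields: "\<forall>y \<in> set ys. length y \<le> N"
    using N length_field_le[of _ ys] by fastforce
  have 1: "runs (copy_to 3 4 {Sep}) (?S (mk l (enc_string z @ Sep # r)) ?e ?e (mk [] (enc_tuple ys)))
      (2 * N + 1) (?S (mk (rev (enc_string z) @ l) (Sep # r)) (mk (rev (enc_string z)) []) ?e (mk [] (enc_tuple ys)))"
    by (rule runs_copy_to[where xs = "enc_string z" and r = "Sep # r" and l = l and l' = "[]"])
      (use N in \<open>auto simp: fun_eq_iff\<close>)
  have 2: "runs (go 3 Go_Right)
      (?S (mk (rev (enc_string z) @ l) (Sep # r)) (mk (rev (enc_string z)) []) ?e (mk [] (enc_tuple ys))) 1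
      (?S (mk ?l r) (mk (rev (enc_string z)) []) ?e (mk [] (enc_tuple ys)))"
    by (rule runs_go_right) (auto simp: fun_eq_iff)
  have 3: "runs (back_to 4 {Blank})
      (?S (mk ?l r) (mk (rev (enc_string z)) []) ?e (mk [] (enc_tuple ys))) (2 * N + 5)
      (?S (mk ?l r) (mk [] (enc_string z)) ?e (mk [] (enc_tuple ys)))"
    by (rule runs_back_to_start[where l = "rev (enc_string z)" and r = "[]"])
      (use N in \<open>auto simp: fun_eq_iff\<close>)
  have "length ys * (20 * N + 41) + 1 \<le> N * (20 * N + 41) + 1"
    using lys(2) by simp
  then have 4: "runs (Loop (\<lambda>h. h 8 \<noteq> Blank) bubble)
      (?S (mk ?l r) (mk [] (enc_string z)) ?e (mk [] (enc_tuple ys)))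
      (N * (20 * N + 41) + 1)
      (?S (mk ?l r) (mk [] ?t) (mk (rev (enc_tuple (low z ys))) []) (mk (rev (enc_tuple ys)) []))"
    using runs_bubbles[of "[]" z N ys R "mk ?l r" "[]"] lys fields by (auto intro: runs_mono)
  have 5: "runs (copy_to 4 5 {Blank})
      (?S (mk ?l r) (mk [] ?t) (mk (rev (enc_tuple (low z ys))) []) (mk (rev (enc_tuple ys)) [])) (2 * N + 1)
      (?S (mk ?l r) (mk (rev ?t) []) (mk (rev ?t @ rev (enc_tuple (low z ys))) []) (mk (rev (enc_tuple ys)) []))"
    by (rule runs_copy_to[where xs = ?t and r = "[]" and l = "[]"])
      (use lt in \<open>auto simp: fun_eq_iff\<close>)
  have 6: "runs (put 5 Sep Go_Right)
      (?S (mk ?l r) (mk (rev ?t) []) (mk (rev ?t @ rev (enc_tuple (low z ys))) []) (mk (rev (enc_tuple ys)) [])) 1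
      (?S (mk ?l r) (mk (rev ?t) []) (mk (rev ?u) []) (mk (rev (enc_tuple ys)) []))"
    by (rule runs_put_end) (auto simp: fun_eq_iff u)
  have 7: "runs (erase 4)
      (?S (mk ?l r) (mk (rev ?t) []) (mk (rev ?u) []) (mk (rev (enc_tuple ys)) [])) (2 * N + 5)
      (?S (mk ?l r) ?e (mk (rev ?u) []) (mk (rev (enc_tuple ys)) []))"
    by (rule runs_erase[where l = "rev ?t"]) (use lt in \<open>auto simp: fun_eq_iff\<close>)
  have 8: "runs (erase 8)
      (?S (mk ?l r) ?e (mk (rev ?u) []) (mk (rev (enc_tuple ys)) [])) (2 * N + 5)
      (?S (mk ?l r) ?e (mk (rev ?u) []) ?e)"
    by (rule runs_erase[where l = "rev (enc_tuple ys)"]) (use lys in \<open>auto simp: fun_eq_iff\<close>)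
  have 9: "runs (back_to 5 {Blank}) (?S (mk ?l r) ?e (mk (rev ?u) []) ?e) (2 * N + 5)
      (?S (mk ?l r) ?e (mk [] ?u) ?e)"
    by (rule runs_back_to_start[where l = "rev ?u" and r = "[]"]) (use lu in \<open>auto simp: fun_eq_iff\<close>)
  have 10: "runs (copy_to 5 8 {Blank}) (?S (mk ?l r) ?e (mk [] ?u) ?e) (2 * N + 1)
      (?S (mk ?l r) ?e (mk (rev ?u) []) (mk (rev ?u) []))"
    by (rule runs_copy_to[where xs = ?u and r = "[]" and l = "[]" and l' = "[]"])
      (use lu in \<open>auto simp: fun_eq_iff\<close>)
  have 11: "runs (erase 5) (?S (mk ?l r) ?e (mk (rev ?u) []) (mk (rev ?u) [])) (2 * N + 5)
      (?S (mk ?l r) ?e ?e (mk (rev ?u) []))"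
    by (rule runs_erase[where l = "rev ?u"]) (use lu in \<open>auto simp: fun_eq_iff\<close>)
  have 12: "runs (back_to 8 {Blank}) (?S (mk ?l r) ?e ?e (mk (rev ?u) [])) (2 * N + 5)
      (?S (mk ?l r) ?e ?e (mk [] ?u))"
    by (rule runs_back_to_start[where l = "rev ?u" and r = "[]"]) (use lu in \<open>auto simp: fun_eq_iff\<close>)
  show ?thesis
    unfolding insert_field_def
    by (rule runs_Seq[OF 1 runs_Seq[OF 2 runs_Seq[OF 3 runs_Seq[OF 4 runs_Seq[OF 5 runs_Seq[OF 6
          runs_Seq[OF 7 runs_Seq[OF 8 runs_Seq[OF 9 runs_Seq[OF 10 runs_Seq[OF 11 12
          order_refl] order_refl] order_refl] order_refl] order_refl] order_refl] order_refl] order_refl]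
          order_refl] order_refl]])
      (simp add: algebra_simps)
qed

text \<open>An insertion moves one field with its separator from \<open>zs\<close> to
  \<open>ys\<close>. The sum of the encoded lengths is thus invariant, and one \<open>N\<close>
  serves every round.\<close>

lemma runs_insert_fields:
  assumes "length (enc_tuple zs) + length (enc_tuple ys) \<le> N"
  shows "runs (Loop (\<lambda>h. h 3 \<noteq> Blank) insert_field)
    (st R (mk l (enc_tuple zs)) (mk [] []) (mk [] []) (mk [] (enc_tuple ys)))
    (length zs * (20 * N * N + 60 * N + 61) + 1)
    (st R (mk (rev (enc_tuple zs) @ l) []) (mk [] []) (mk [] []) (mk [] (enc_tuple (fold ins zs ys))))"
  using assms
proof (induction zs arbitrary: ys l)
  case Nil
  then show ?case
    by (intro runs_Loop_exit) auto
next
  case (Cons z zs)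
  have step: "runs insert_field
    (st R (mk l (enc_string z @ Sep # enc_tuple zs)) (mk [] []) (mk [] []) (mk [] (enc_tuple ys)))
    (20 * N * N + 60 * N + 60)
    (st R (mk (Sep # rev (enc_string z) @ l) (enc_tuple zs)) (mk [] []) (mk [] []) (mk [] (enc_tuple (ins z ys))))"
    using Cons.prems by (intro runs_insert_field) auto
  have rest: "runs (Loop (\<lambda>h. h 3 \<noteq> Blank) insert_field)
    (st R (mk (Sep # rev (enc_string z) @ l) (enc_tuple zs)) (mk [] []) (mk [] []) (mk [] (enc_tuple (ins z ys))))
    (length zs * (20 * N * N + 60 * N + 61) + 1)
    (st R (mk (rev (enc_tuple (z # zs)) @ l) []) (mk [] []) (mk [] []) (mk [] (enc_tuple (fold ins (z # zs) ys))))"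
    using Cons.IH[of "ins z ys" "Sep # rev (enc_string z) @ l"] Cons.prems
    by (simp add: length_enc_ins del: fun_upd_apply)
  have ne: "hdb (enc_tuple (z # zs)) \<noteq> Blank"
    unfolding hdb_enc_tuple by simp
  show ?case
    by (rule runs_Loop_enter[OF _ step[folded enc_tuple_simps(2)] rest]) (use ne in simp_all)
qed

text \<open>The input survives on tape 3 in its original order, which is the order of the answers;
  tape 0 is cleared to receive them from cell 0 on.\<close>

definition sort_input :: cmd where
  "sort_input =
     (copy_to 0 3 {Blank} ;; erase 0 ;; back_to 3 {Blank} ;;
      Loop (\<lambda>h. h 3 \<noteq> Blank) insert_field ;; back_to 3 {Blank})"

lemma runs_sort_input:
  assumes N: "N = length (enc_tuple zs)"
  shows "runs sort_input (init_store (enc_tuple zs)) (N * (20 * N * N + 60 * N + 61) + 8 * N + 30)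
    ((\<lambda>_. mk [] [])(3 := mk [] (enc_tuple zs), 8 := mk [] (enc_tuple (isort zs))))"
proof -
  let ?w = "enc_tuple zs"
  let ?E = "(\<lambda>_. mk [] []) :: store"
  have 1: "runs (copy_to 0 3 {Blank}) (init_store ?w) (2 * N + 1)
      (?E(0 := mk (rev ?w) [], 3 := mk (rev ?w) []))"
    by (rule runs_copy_to[where xs = ?w and r = "[]" and l = "[]" and l' = "[]"])
      (use N in \<open>auto simp: init_store_def fun_eq_iff\<close>)
  have 2: "runs (erase 0) (?E(0 := mk (rev ?w) [], 3 := mk (rev ?w) [])) (2 * N + 5)
      (?E(3 := mk (rev ?w) []))"
    by (rule runs_erase[where l = "rev ?w"]) (use N in \<open>auto simp: fun_eq_iff\<close>)
  have 3: "runs (back_to 3 {Blank}) (?E(3 := mk (rev ?w) [])) (2 * N + 5)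
     (st ?E (mk [] ?w) (mk [] []) (mk [] []) (mk [] []))"
    by (rule runs_back_to_start[where l = "rev ?w" and r = "[]"]) (use N in \<open>auto simp: fun_eq_iff\<close>)
  have "length zs * (20 * N * N + 60 * N + 61) + 1 \<le> N * (20 * N * N + 60 * N + 61) + 1"
    using length_le_enc_tuple[of zs] N by (intro add_mono mult_right_mono) auto
  then have 4: "runs (Loop (\<lambda>h. h 3 \<noteq> Blank) insert_field)
     (st ?E (mk [] ?w) (mk [] []) (mk [] []) (mk [] [])) (N * (20 * N * N + 60 * N + 61) + 1)
     (st ?E (mk (rev ?w) []) (mk [] []) (mk [] []) (mk [] (enc_tuple (isort zs))))"
    using runs_insert_fields[of zs "[]" N ?E "[]"] N by (auto simp: isort_def intro: runs_mono)
  have 5: "runs (back_to 3 {Blank})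
     (st ?E (mk (rev ?w) []) (mk [] []) (mk [] []) (mk [] (enc_tuple (isort zs)))) (2 * N + 5)
     (?E(3 := mk [] ?w, 8 := mk [] (enc_tuple (isort zs))))"
    by (rule runs_back_to_start[where l = "rev ?w" and r = "[]"]) (use N in \<open>auto simp: fun_eq_iff\<close>)
  show ?thesis
    unfolding sort_input_def
    by (rule runs_Seq[OF 1 runs_Seq[OF 2 runs_Seq[OF 3 runs_Seq[OF 4 5 order_refl] order_refl] order_refl]])
      simp
qed

section \<open>Running a given machine\<close>

text \<open>When \<open>M\<close> halts, its output head can be anywhere. Its moves are therefore logged, and undone
  in reverse order to find the start of the output.\<close>

fun log_symbol :: "move \<Rightarrow> symbol" where
  "log_symbol Go_Left = Bit False"
| "log_symbol Stay = Sep"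
| "log_symbol Go_Right = Bit True"

definition undo :: "symbol \<Rightarrow> move" where
  "undo s = (if s = Bit False then Go_Right else if s = Bit True then Go_Left else Stay)"

lemma displacement_undo [simp]: "displacement (undo (log_symbol m)) = - displacement m"
  by (cases m) (auto simp: undo_def)

lemma log_symbol_neq_Blank [simp]: "log_symbol m \<noteq> Blank"
  by (cases m) auto

text \<open>The state is kept on tape 1 as \<open>Aux q\<close>, so that running \<open>M\<close> is a loop around one action.\<close>

definition simulate_step :: "tm \<Rightarrow> (nat \<Rightarrow> symbol) \<Rightarrow> nat \<Rightarrow> symbol \<times> move" where
  "simulate_step M h =
     (let q = (case h 1 of Aux q \<Rightarrow> q | _ \<Rightarrow> 0);
          as = map (\<lambda>i. h (8 + i)) [0..<tapes M];
          r = delta M q as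
      in if q \<in> states M \<and> set as \<subseteq> alphabet M
         then \<lambda>i. if i = 1 then (Aux (fst r), Stay)
                  else if i = 2 then (log_symbol (snd (snd r ! 0)), Go_Right)
                  else if 8 \<le> i \<and> i < 8 + tapes M then snd r ! (i - 8)
                  else (h i, Stay)
         else idle h)"

definition rewind_step :: "(nat \<Rightarrow> symbol) \<Rightarrow> nat \<Rightarrow> symbol \<times> move" where
  "rewind_step h = (idle h)(2 := (h 2, Go_Left), 8 := (h 8, undo (h 2)))"

definition simulate :: "tm \<Rightarrow> cmd" where
  "simulate M =
     (put 1 (Aux (start M)) Stay ;; Loop (\<lambda>h. h 1 \<noteq> Aux (halt M)) (Act (simulate_step M)) ;;
      go 2 Go_Left ;; Loop (\<lambda>h. h 2 \<noteq> Blank) (Act rewind_step))"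

text \<open>\<open>wf_tm\<close> restrains \<open>delta\<close> only on states and symbols of the
  machine. As the heads may reach any cell, the invariant speaks of all cells.\<close>

definition valid_config :: "tm \<Rightarrow> config \<Rightarrow> bool" where
  "valid_config M c \<longleftrightarrow> fst c \<in> states M \<and> length (snd c) = tapes M \<and>
     (\<forall>t \<in> set (snd c). \<forall>x. fst t x \<in> alphabet M)"

lemma delta_valid:
  assumes "wf_tm M" "valid_config M c"
  defines "r \<equiv> delta M (fst c) (map scan (snd c))"
  shows "fst r \<in> states M" "length (snd r) = tapes M" "fst ` set (snd r) \<subseteq> alphabet M"
proof -
  have "length (map scan (snd c)) = tapes M \<and> set (map scan (snd c)) \<subseteq> alphabet M"
    using assms(2) by (auto simp: valid_config_def scan_def)
  then show "fst r \<in> states M" "length (snd r) = tapes M" "fst ` set (snd r) \<subseteq> alphabet M"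
    using assms(1,2) unfolding wf_tm_def valid_config_def r_def by blast+
qed

lemma step_eq:
  "fst c \<noteq> halt M \<Longrightarrow>
   step M c = (fst (delta M (fst c) (map scan (snd c))), map2 act (snd c) (snd (delta M (fst c) (map scan (snd c)))))"
  by (simp add: step_def scan_def[abs_def] Let_def)

lemma valid_step:
  assumes "wf_tm M" "valid_config M c"
  shows "valid_config M (step M c)"
proof (cases "fst c = halt M")
  case True
  then show ?thesis
    using assms by (simp add: step_def)
next
  case False
  note r = delta_valid[OF assms]
  have "fst (act t a) x \<in> alphabet M"
    if "(t, a) \<in> set (zip (snd c) (snd (delta M (fst c) (map scan (snd c)))))" for t a x
    using assms(2) r(3) set_zip_leftD[OF that] set_zip_rightD[OF that]
    by (auto simp: valid_config_def act_def)
  then show ?thesis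
    using assms(2) r by (auto simp: valid_config_def step_eq[OF False])
qed

lemma valid_initial:
  assumes "wf_tm M" "set w \<subseteq> alphabet M"
  shows "valid_config M (initial M w)"
proof -
  have "inscription w x \<in> alphabet M" for x
    using assms nth_mem[of "nat x" w] by (auto simp: inscription_def wf_tm_def nat_less_iff)
  then show ?thesis
    using assms by (auto simp: valid_config_def initial_def wf_tm_def)
qed

text \<open>The log is the left part of a zipper, so \<open>lg\<close> lists the latest move first,
  in the order in which the moves are undone.\<close>

definition emb :: "store \<Rightarrow> nat \<Rightarrow> symbol list \<Rightarrow> tape list \<Rightarrow> store" where
  "emb R q lg ts i =
     (if i = 1 then mk [] [Aux q] else if i = 2 then mk lg []
      else if 8 \<le> i \<and> i < 8 + length ts then ts ! (i - 8) else R i)"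

lemma runs_simulate_step:
  assumes "wf_tm M" "valid_config M (q, ts)" "q \<noteq> halt M" "step M (q, ts) = (q', ts')"
  obtains m where "runs (Act (simulate_step M)) (emb R q lg ts) 1 (emb R q' (log_symbol m # lg) ts')"
    "snd (ts' ! 0) = snd (ts ! 0) + displacement m"
proof -
  define r where "r = delta M q (map scan ts)"
  note v = delta_valid[OF assms(1,2), folded r_def, simplified, folded r_def]
  have k: "1 \<le> tapes M" and len: "length ts = tapes M" and q: "q \<in> states M"
    using assms(1,2) by (auto simp: wf_tm_def valid_config_def)
  have q': "q' = fst r" and ts': "ts' = map2 act ts (snd r)"
    using step_eq[of "(q, ts)" M] assms(3,4) by (simp_all add: r_def)
  have heads: "map (\<lambda>i. (scan \<circ> emb R q lg ts) (8 + i)) [0..<tapes M] = map scan ts"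
    by (intro nth_equalityI) (auto simp: emb_def len)
  have state: "(case (scan \<circ> emb R q lg ts) 1 of Aux q \<Rightarrow> q | _ \<Rightarrow> 0) = q"
    by (simp add: emb_def)
  have sub: "set (map scan ts) \<subseteq> alphabet M"
    using assms(2) by (auto simp: valid_config_def scan_def)
  have s: "simulate_step M (scan \<circ> emb R q lg ts) = (\<lambda>i. if i = 1 then (Aux q', Stay)
                  else if i = 2 then (log_symbol (snd (snd r ! 0)), Go_Right)
                  else if 8 \<le> i \<and> i < 8 + tapes M then snd r ! (i - 8)
                  else ((scan \<circ> emb R q lg ts) i, Stay))"
    unfolding simulate_step_def heads state Let_def r_def[symmetric] q'[symmetric] using q sub by simp
  have "runs (Act (simulate_step M)) (emb R q lg ts) 1 (emb R q' (log_symbol (snd (snd r ! 0)) # lg) ts')"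
    by (rule runs_Act) (use len v in \<open>auto simp: s emb_def fun_eq_iff ts' act_stay\<close>)
  moreover have "snd (ts' ! 0) = snd (ts ! 0) + displacement (snd (snd r ! 0))"
    using k len v(2) by (simp add: ts' act_def)
  ultimately show ?thesis
    by (rule that)
qed

text \<open>If \<open>M\<close> halts before step \<open>t\<close>, its configuration no longer
  changes while the loop is left at once; so \<open>2 * t + 1\<close> is only an upper bound. The
  last conjunct is the invariant behind rewinding: the inverses of all logged moves add up to the
  way back to the initial position.\<close>

lemma runs_simulate_loop:
  assumes "wf_tm M" "valid_config M (q, ts)" "(step M ^^ t) (q, ts) = (halt M, ts')"
  shows "\<exists>lg'. runs (Loop (\<lambda>h. h 1 \<noteq> Aux (halt M)) (Act (simulate_step M))) (emb R q lg ts) (2 * t + 1)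
      (emb R (halt M) (lg' @ lg) ts') \<and> length lg' \<le> t \<and> Blank \<notin> set lg' \<and>
    snd (ts' ! 0) + (\<Sum>s\<leftarrow>lg'. displacement (undo s)) = snd (ts ! 0)"
  using assms(2,3)
proof (induction t arbitrary: q ts lg)
  case 0
  then show ?case
    by (intro exI[of _ "[]"] conjI runs_Loop_exit) (auto simp: emb_def)
next
  case (Suc t)
  show ?case
  proof (cases "q = halt M")
    case True
    then have "step M (q, ts) = (q, ts)"
      by (simp add: step_def)
    then have "(step M ^^ Suc t) (q, ts) = (q, ts)"
      by (induction t) simp_all
    then show ?thesis
      using Suc.prems True by (intro exI[of _ "[]"] conjI runs_Loop_exit) (auto simp: emb_def)
  next
    case False
    obtain q1 ts1 where s: "step M (q, ts) = (q1, ts1)"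
      by fastforce
    obtain m where m: "runs (Act (simulate_step M)) (emb R q lg ts) 1 (emb R q1 (log_symbol m # lg) ts1)"
      "snd (ts1 ! 0) = snd (ts ! 0) + displacement m"
      using runs_simulate_step[OF assms(1) Suc.prems(1) False s] by blast
    have "valid_config M (q1, ts1)" "(step M ^^ t) (q1, ts1) = (halt M, ts')"
      using valid_step[OF assms(1) Suc.prems(1)] Suc.prems(2) s by (simp_all add: funpow_swap1)
    then obtain lg' where lg': "runs (Loop (\<lambda>h. h 1 \<noteq> Aux (halt M)) (Act (simulate_step M)))
        (emb R q1 (log_symbol m # lg) ts1) (2 * t + 1) (emb R (halt M) (lg' @ log_symbol m # lg) ts')"
      "length lg' \<le> t" "Blank \<notin> set lg'"
      "snd (ts' ! 0) + (\<Sum>s\<leftarrow>lg'. displacement (undo s)) = snd (ts1 ! 0)"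
      using Suc.IH by blast
    have "runs (Loop (\<lambda>h. h 1 \<noteq> Aux (halt M)) (Act (simulate_step M))) (emb R q lg ts) (2 * Suc t + 1)
      (emb R (halt M) ((lg' @ [log_symbol m]) @ lg) ts')"
      by (rule runs_Loop_enter[OF _ m(1)]) (use lg'(1) False in \<open>auto simp: emb_def\<close>)
    moreover have "Blank \<noteq> log_symbol m"
      using log_symbol_neq_Blank[of m] by metis
    ultimately show ?thesis
      using lg' m(2) by (intro exI[of _ "lg' @ [log_symbol m]"]) auto
  qed
qed

lemma act_scan: "act t (scan t, m) = (fst t, snd t + displacement m)"
  by (simp add: act_def scan_def)

text \<open>The head of tape 2 starts on the latest entry and leaves the log at its left end. Tape 8
  is only moved: each scanned symbol is written back.\<close>

lemma runs_rewind_loop: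
  assumes "T 2 = mk lg (s # r)" "Blank \<notin> set (s # lg)"
  shows "\<exists>T'. runs (Loop (\<lambda>h. h 2 \<noteq> Blank) (Act rewind_step)) T (2 * length lg + 3) T' \<and>
    T' 8 = (fst (T 8), snd (T 8) + (\<Sum>s\<leftarrow>s # lg. displacement (undo s))) \<and>
    (\<forall>i. i \<noteq> 2 \<and> i \<noteq> 8 \<longrightarrow> T' i = T i)"
  using assms
proof (induction lg arbitrary: T s r)
  case Nil
  let ?T = "T(2 := lft (s # r), 8 := (fst (T 8), snd (T 8) + displacement (undo s)))"
  have 1: "runs (Act rewind_step) T 1 ?T"
    by (rule runs_Act)
      (use Nil act_left_Nil[of "s # r"] in \<open>auto simp: rewind_step_def idle_def fun_eq_iff act_scan[of "T 8"]\<close>)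
  have 2: "runs (Loop (\<lambda>h. h 2 \<noteq> Blank) (Act rewind_step)) ?T 1 ?T"
    by (rule runs_Loop_exit) auto
  show ?case
    by (intro exI[of _ ?T] conjI runs_Loop_enter[OF _ 1 2]) (use Nil in auto)
next
  case (Cons y lg)
  let ?T = "T(2 := mk lg (y # s # r), 8 := (fst (T 8), snd (T 8) + displacement (undo s)))"
  have 1: "runs (Act rewind_step) T 1 ?T"
    by (rule runs_Act)
      (use Cons.prems act_left'[of y lg "s # r"] in \<open>auto simp: rewind_step_def idle_def fun_eq_iff act_scan[of "T 8"]\<close>)
  have "\<exists>T'. runs (Loop (\<lambda>h. h 2 \<noteq> Blank) (Act rewind_step)) ?T (2 * length lg + 3) T' \<and>
    T' 8 = (fst (?T 8), snd (?T 8) + (\<Sum>s\<leftarrow>y # lg. displacement (undo s))) \<and>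
    (\<forall>i. i \<noteq> 2 \<and> i \<noteq> 8 \<longrightarrow> T' i = ?T i)"
    by (rule Cons.IH) (use Cons.prems in auto)
  then obtain T' where T': "runs (Loop (\<lambda>h. h 2 \<noteq> Blank) (Act rewind_step)) ?T (2 * length lg + 3) T'"
    "T' 8 = (fst (?T 8), snd (?T 8) + (\<Sum>s\<leftarrow>y # lg. displacement (undo s)))"
    "\<forall>i. i \<noteq> 2 \<and> i \<noteq> 8 \<longrightarrow> T' i = ?T i"
    by blast
  show ?case
    by (intro exI[of _ T'] conjI runs_Loop_enter[OF _ 1 T'(1)]) (use T' Cons.prems in auto)
qed

lemma runs_simulate:
  assumes M: "wf_tm M" and w: "set w \<subseteq> alphabet M"
    and halt: "(step M ^^ t) (initial M w) = (halt M, ts)" and u: "fst (ts ! 0) = inscription u"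
    and T: "\<forall>i. i \<noteq> 3 \<and> i \<noteq> 8 \<longrightarrow> T i = mk [] []" "T 8 = mk [] w"
  shows "\<exists>T'. runs (simulate M) T (4 * t + 20) T' \<and> T' 8 = mk [] u \<and>
    (\<forall>i. i \<noteq> 1 \<and> i \<noteq> 2 \<and> i < 8 \<longrightarrow> T' i = T i)"
proof -
  let ?ts = "(inscription w, 0) # replicate (tapes M - 1) (\<lambda>_. Blank, 0)"
  have k: "1 \<le> tapes M"
    using M by (simp add: wf_tm_def)
  have e: "mk [] [] = (\<lambda>_. Blank, 0)"
    by (auto simp: mk_def inscription_def fun_eq_iff)
  have init: "initial M w = (start M, ?ts)"
    by (simp add: initial_def)
  obtain lg where lg: "runs (Loop (\<lambda>h. h 1 \<noteq> Aux (halt M)) (Act (simulate_step M)))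
      (emb T (start M) [] ?ts) (2 * t + 1) (emb T (halt M) lg ts)"
    "length lg \<le> t" "Blank \<notin> set lg" "snd (ts ! 0) + (\<Sum>s\<leftarrow>lg. displacement (undo s)) = 0"
    using runs_simulate_loop[OF M valid_initial[OF M w, unfolded init] halt[unfolded init], of T "[]"] by auto
  have 1: "runs (put 1 (Aux (start M)) Stay) T 1 (emb T (start M) [] ?ts)"
  proof (rule runs_put)
    have "T i = ?ts ! (i - 8)" if "8 \<le> i" "i < 8 + tapes M" for i
      using that T k by (cases "i = 8") (simp_all add: e mk_def[of "[]" w] nth_Cons')
    then show "emb T (start M) [] ?ts = T(1 := act (T 1) (Aux (start M), Stay))"
      using T k by (auto simp: emb_def fun_eq_iff act_stay)
  qed simp
  have valid: "valid_config M (halt M, ts)"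
  proof -
    have "valid_config M ((step M ^^ t) (initial M w))"
      by (induction t) (auto simp: valid_initial[OF M w] valid_step[OF M])
    then show ?thesis
      by (simp add: halt)
  qed
  then have len: "length ts = tapes M"
    by (simp add: valid_config_def)
  let ?T2 = "emb T (halt M) lg ts"
  have T28: "?T2 8 = ts ! 0"
    using len k by (simp add: emb_def)
  have "\<exists>T'. runs (go 2 Go_Left ;; Loop (\<lambda>h. h 2 \<noteq> Blank) (Act rewind_step)) ?T2 (2 * t + 10) T' \<and>
    T' 8 = (fst (?T2 8), snd (?T2 8) + (\<Sum>s\<leftarrow>lg. displacement (undo s))) \<and>
    (\<forall>i. i \<noteq> 2 \<and> i \<noteq> 8 \<longrightarrow> T' i = ?T2 i)"
  proof (cases lg)
    \<comment> \<open>The log is empty if \<open>M\<close> starts in its halting state.\<close>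
    case Nil
    have 1: "runs (go 2 Go_Left) ?T2 1 (?T2(2 := lft []))"
      by (rule runs_go) (use Nil act_left_Nil[of "[]"] in \<open>auto simp: emb_def\<close>)
    have 2: "runs (Loop (\<lambda>h. h 2 \<noteq> Blank) (Act rewind_step)) (?T2(2 := lft [])) 1 (?T2(2 := lft []))"
      by (rule runs_Loop_exit) auto
    show ?thesis
      by (intro exI[of _ "?T2(2 := lft [])"] conjI runs_Seq[OF 1 2]) (use Nil in auto)
  next
    case (Cons s lg')
    let ?T3 = "?T2(2 := mk lg' [s])"
    have 1: "runs (go 2 Go_Left) ?T2 1 ?T3"
      by (rule runs_go) (use Cons act_left'[of s lg' "[]"] in \<open>auto simp: emb_def\<close>)
    have "\<exists>T'. runs (Loop (\<lambda>h. h 2 \<noteq> Blank) (Act rewind_step)) ?T3 (2 * length lg' + 3) T' \<and>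
      T' 8 = (fst (?T3 8), snd (?T3 8) + (\<Sum>s\<leftarrow>s # lg'. displacement (undo s))) \<and>
      (\<forall>i. i \<noteq> 2 \<and> i \<noteq> 8 \<longrightarrow> T' i = ?T3 i)"
      by (rule runs_rewind_loop) (use lg(3) Cons in auto)
    then obtain T' where T': "runs (Loop (\<lambda>h. h 2 \<noteq> Blank) (Act rewind_step)) ?T3 (2 * length lg' + 3) T'"
      "T' 8 = (fst (?T3 8), snd (?T3 8) + (\<Sum>s\<leftarrow>s # lg'. displacement (undo s)))"
      "\<forall>i. i \<noteq> 2 \<and> i \<noteq> 8 \<longrightarrow> T' i = ?T3 i"
      by blast
    show ?thesis
      by (intro exI[of _ T'] conjI runs_Seq[OF 1 T'(1)]) (use T' lg(2) Cons in auto)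
  qed
  then obtain T' where T': "runs (go 2 Go_Left ;; Loop (\<lambda>h. h 2 \<noteq> Blank) (Act rewind_step)) ?T2 (2 * t + 10) T'"
    "T' 8 = (fst (?T2 8), snd (?T2 8) + (\<Sum>s\<leftarrow>lg. displacement (undo s)))"
    "\<forall>i. i \<noteq> 2 \<and> i \<noteq> 8 \<longrightarrow> T' i = ?T2 i"
    by blast
  have "runs (simulate M) T (4 * t + 20) T'"
    unfolding simulate_def by (rule runs_Seq[OF 1 runs_Seq[OF lg(1) T'(1) order_refl]]) simp
  moreover have "T' 8 = mk [] u"
    unfolding T'(2) T28 lg(4) u by (simp add: mk_def)
  moreover have "T' i = T i" if "i \<noteq> 1" "i \<noteq> 2" "i < 8" for i
    using T'(3) that by (simp add: emb_def)
  ultimately show ?thesis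
    by blast
qed

section \<open>Admissibility of the simulation and size of the simulated output\<close>

lemma wf_simulate:
  assumes M: "wf_tm M" and A: "alphabet M \<subseteq> A" "Aux ` states M \<subseteq> A" and K: "8 + tapes M \<le> K"
  shows "wf_cmd K A (simulate M)"
proof -
  have k: "1 \<le> tapes M" and start: "start M \<in> states M"
    and bits: "Bit False \<in> A" "Bit True \<in> A" "Sep \<in> A"
    using M A by (auto simp: wf_tm_def)
  have log: "log_symbol m \<in> A" for m
    using bits by (cases m) auto
  have "local_on K (\<lambda>h. simulate_step M h i)" if "i < K" for i
    unfolding local_on_def
  proof (intro allI impI)
    fix h h' :: "nat \<Rightarrow> symbol" assume eq: "\<forall>i<K. h i = h' i"
    have 1: "map (\<lambda>i. h (8 + i)) [0..<tapes M] = map (\<lambda>i. h' (8 + i)) [0..<tapes M]"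
      using eq K by auto
    have 2: "h 1 = h' 1" "h i = h' i"
      using eq K that by auto
    show "simulate_step M h i = simulate_step M h' i"
      unfolding simulate_step_def Let_def 1 2(1) using 2(2) by (simp add: idle_def)
  qed
  moreover have "fst (simulate_step M h i) \<in> A" if h: "\<forall>i<K. h i \<in> A" and i: "i < K" for h i
  proof -
    define q where "q = (case h 1 of Aux q \<Rightarrow> q | _ \<Rightarrow> 0)"
    define as where "as = map (\<lambda>i. h (8 + i)) [0..<tapes M]"
    show ?thesis
    \<comment> \<open>Here the guard in \<open>simulate_step\<close> pays off: arbitrary symbols of
      \<open>A\<close> may be scanned, but \<open>delta M\<close> is known to behave well only on
      states and symbols of \<open>M\<close>.\<close>
    proof (cases "q \<in> states M \<and> set as \<subseteq> alphabet M")
      case True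
      then have "fst (delta M q as) \<in> states M" "length (snd (delta M q as)) = tapes M"
        "fst ` set (snd (delta M q as)) \<subseteq> alphabet M"
        using M by (auto simp: wf_tm_def as_def)
      moreover from this have "fst (snd (delta M q as) ! j) \<in> A" if "j < tapes M" for j
        using that A(1) by (metis image_eqI nth_mem subsetD)
      ultimately show ?thesis
        unfolding simulate_step_def q_def[symmetric] as_def[symmetric] Let_def
        using True h i A log by auto
    next
      case False
      then show ?thesis
        unfolding simulate_step_def q_def[symmetric] as_def[symmetric] Let_def
        using h i by (auto simp: idle_def)
    qed
  qed
  moreover have "wf_cmd K A (Act rewind_step)"
    using K k by (auto simp: rewind_step_def local_on_def idle_def)
  moreover have "local_on K (\<lambda>h. h 1 \<noteq> Aux (halt M))" "local_on K (\<lambda>h. h 2 \<noteq> Blank)"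
    using K by (auto simp: local_on_def)
  ultimately show ?thesis
    using K k A(2) start by (auto simp: simulate_def)
qed

text \<open>A step makes at most one further cell of the first tape nonblank, and a blank-free
  output fills \<open>length u\<close> cells. This bounds the list of selected strings, which every
  query has to be compared with.\<close>

lemma length_output_le:
  assumes "(step M ^^ t) (initial M w) = (q, ts)" "wf_tm M" "set w \<subseteq> alphabet M"
    "fst (ts ! 0) = inscription u" "Blank \<notin> set u"
  shows "length u \<le> length w + t"
proof -
  define supp where "supp c = {x. fst (snd c ! 0) x \<noteq> Blank}" for c :: config
  have supp_inscription: "{x. inscription v x \<noteq> Blank} \<subseteq> int ` {..<length v}" for v
    by (auto simp: inscription_def image_iff intro!: bexI[of _ "nat _"] split: if_splits)
  have k: "1 \<le> tapes M"
    using assms(2) by (simp add: wf_tm_def)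
  have grow: "supp (step M c) \<subseteq> insert (snd (snd c ! 0)) (supp c)" if "valid_config M c" for c
  proof (cases "fst c = halt M")
    case False
    have "snd (step M c) ! 0 = act (snd c ! 0) (snd (delta M (fst c) (map scan (snd c))) ! 0)"
      using k that delta_valid(2)[OF assms(2) that]
      by (simp add: step_eq[OF False] valid_config_def)
    then show ?thesis
      by (auto simp: supp_def act_def split: if_splits)
  qed (auto simp: step_def)
  have "valid_config M ((step M ^^ t) (initial M w)) \<and>
    finite (supp ((step M ^^ t) (initial M w))) \<and> card (supp ((step M ^^ t) (initial M w))) \<le> length w + t"
  proof (induction t)
    case 0
    have "supp (initial M w) \<subseteq> int ` {..<length w}"
      using supp_inscription[of w] by (simp add: supp_def initial_def)
    then have "finite (supp (initial M w)) \<and> card (supp (initial M w)) \<le> length w"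
      using card_mono[of "int ` {..<length w}"] finite_subset by (fastforce simp: card_image)
    then show ?case
      using valid_initial[OF assms(2,3)] by simp
  next
    case (Suc t)
    let ?c = "(step M ^^ t) (initial M w)"
    have "finite (insert (snd (snd ?c ! 0)) (supp ?c))"
      using Suc by simp
    moreover have "card (insert (snd (snd ?c ! 0)) (supp ?c)) \<le> Suc (card (supp ?c))"
      using Suc by (simp add: card_insert_if)
    moreover have "supp (step M ?c) \<subseteq> insert (snd (snd ?c ! 0)) (supp ?c)"
      using grow Suc by blast
    ultimately have "finite (supp (step M ?c)) \<and> card (supp (step M ?c)) \<le> Suc (card (supp ?c))"
      by (meson card_mono finite_subset le_trans)
    then show ?case
      using Suc valid_step[OF assms(2)] by auto
  qed
  then have c: "finite (supp (q, ts))" "card (supp (q, ts)) \<le> length w + t"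
    by (simp_all add: assms(1))
  have "int ` {..<length u} \<subseteq> supp (q, ts)"
    using assms(4,5) by (auto simp: supp_def inscription_def in_set_conv_nth)
  then have "card (int ` {..<length u}) \<le> card (supp (q, ts))"
    using c(1) by (intro card_mono)
  then show ?thesis
    using c(2) by (simp add: card_image)
qed

section \<open>Answering the queries\<close>

text \<open>The life of a flag while the fields of \<open>ws\<close> are compared with
  \<open>z\<close>, each occurrence applying \<open>a\<close> once. A constant \<open>False\<close>
  tests for membership; \<open>Not\<close> counts occurrences modulo 2.\<close>

definition field_fold :: "(bool \<Rightarrow> bool) \<Rightarrow> bool list \<Rightarrow> bool list list \<Rightarrow> bool \<Rightarrow> bool" where
  "field_fold a z ws = fold (\<lambda>w b. if w = z then a b else b) ws"

text \<open>\<open>ws\<close> are the selected strings and \<open>es\<close> the strings preceding \<open>z\<close> in the input.\<close>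

definition verdict :: "bool list list \<Rightarrow> bool list list \<Rightarrow> bool list \<Rightarrow> bool" where
  "verdict ws es z = field_fold Not z es (field_fold (\<lambda>_. False) z ws True)"

fun verdicts :: "bool list list \<Rightarrow> bool list list \<Rightarrow> bool list list \<Rightarrow> bool list" where
  "verdicts ws es [] = []"
| "verdicts ws es (z # zs) = verdict ws es z # verdicts ws (es @ [z]) zs"

definition set_flag :: "(bool \<Rightarrow> bool) \<Rightarrow> cmd" where
  "set_flag a = Act (\<lambda>h. (idle h)(7 := (Bit (a (h 7 = Bit True)), Stay)))"

definition emit :: "nat \<Rightarrow> nat \<Rightarrow> cmd" where
  "emit i j = Act (\<lambda>h. (idle h)(j := (h i, Go_Right)))"

lemma runs_emit: "T' = T(j := act (T j) (scan (T i), Go_Right)) \<Longrightarrow> runs (emit i j) T 1 T'"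
  unfolding emit_def by (rule runs_Act) (auto simp: act_idle_upd fun_eq_iff)

text \<open>A field equals the string on tape 4 exactly if both are exhausted when the heads first
  disagree. \<open>go 7 Stay\<close> does nothing.\<close>

definition scan_fields :: "nat \<Rightarrow> (bool \<Rightarrow> bool) \<Rightarrow> cmd" where
  "scan_fields i a = Loop (\<lambda>h. h i \<noteq> Blank)
     (match_loop i 4 ;;
      Branch (\<lambda>h. h i = Sep \<and> h 4 = Blank) (set_flag a) (go 7 Stay) ;;
      skip_to i {Sep} ;; go i Go_Right ;; back_to 4 {Blank})"

lemma runs_scan_fields:
  assumes "T i = mk m (enc_tuple ws)" "T 4 = mk [] (enc_string z)" "T 7 = mk [] [Bit b]"
    and i: "i \<noteq> 4" "i \<noteq> 7" and Q: "length z \<le> Q" "\<forall>w \<in> set ws. length w \<le> Q"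
  shows "runs (scan_fields i a) T (length ws * (6 * Q + 20) + 1)
    (T(i := mk (rev (enc_tuple ws) @ m) [], 7 := mk [] [Bit (field_fold a z ws b)]))"
  using assms
proof (induction ws arbitrary: T m b)
  case Nil
  then show ?case
    unfolding scan_fields_def field_fold_def by (intro runs_Loop_exit) (auto simp: fun_eq_iff)
next
  case (Cons w ws)
  let ?b = "if w = z then a b else b"
  obtain p w' z' where p: "w = p @ w'" "z = p @ z'" "w' = [] \<or> z' = [] \<or> hd w' \<noteq> hd z'"
    by (rule common_prefix)
  let ?r = "enc_tuple ws"
  let ?m = "rev (enc_string w) @ m"
  let ?T1 = "T(i := mk (rev (enc_string p) @ m) (enc_string w' @ Sep # ?r), 4 := mk (rev (enc_string p)) (enc_string z'))"
  let ?T2 = "?T1(7 := mk [] [Bit ?b])"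
  have enc_app: "enc_string (u @ v) = enc_string u @ enc_string v" for u v
    by (simp add: enc_string_def)
  have len: "length p \<le> Q" "length w' \<le> Q"
    using Cons.prems(7) p by auto
  have differ: "hdb (enc_string w' @ Sep # ?r) \<noteq> hdb (enc_string z')"
    using p(3) by (cases w'; cases z') (auto simp: enc_string_def)
  have 1: "runs (match_loop i 4) T (2 * Q + 1) ?T1"
    by (rule runs_match_loop[where p = "enc_string p" and l = m and l' = "[]"])
      (use p len differ i Cons.prems in \<open>auto simp: enc_app fun_eq_iff\<close>)
  have test: "hdb (enc_string w' @ Sep # ?r) = Sep \<and> hdb (enc_string z') = Blank \<longleftrightarrow> w = z"
    unfolding p(1,2) using p(3) by (cases w'; cases z') (auto simp: enc_string_def)
  have 2: "runs (Branch (\<lambda>h. h i = Sep \<and> h 4 = Blank) (set_flag a) (go 7 Stay)) ?T1 2 ?T2"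
  proof (cases "w = z")
    case True
    have "runs (set_flag a) ?T1 1 ?T2"
      unfolding set_flag_def
      by (rule runs_Act) (use True i Cons.prems in \<open>auto simp: fun_eq_iff idle_def act_stay\<close>)
    then show ?thesis
      by (rule runs_Branch_True[rotated]) (use True test i in auto)
  next
    case False
    have "runs (go 7 Stay) ?T1 1 ?T2"
      by (rule runs_go) (use False i Cons.prems in \<open>auto simp: fun_eq_iff act_stay\<close>)
    then show ?thesis
      by (rule runs_Branch_False[rotated]) (use False test i in auto)
  qed
  let ?T3 = "?T2(i := mk ?m (Sep # ?r))"
  have 3: "runs (skip_to i {Sep}) ?T2 (2 * Q + 1) ?T3"
    by (rule runs_skip_to[where xs = "enc_string w'" and r = "Sep # ?r" and l = "rev (enc_string p) @ m"])
      (use p len i in \<open>auto simp: enc_app fun_eq_iff\<close>)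
  let ?T4 = "?T2(i := mk (Sep # ?m) ?r)"
  have 4: "runs (go i Go_Right) ?T3 1 ?T4"
    by (rule runs_go_right) (auto simp: fun_eq_iff)
  let ?T5 = "T(i := mk (Sep # ?m) ?r, 7 := mk [] [Bit ?b])"
  have 5: "runs (back_to 4 {Blank}) ?T4 (2 * Q + 5) ?T5"
    by (rule runs_back_to_start[where l = "rev (enc_string p)" and r = "enc_string z'"])
      (use p len i Cons.prems in \<open>auto simp: enc_app fun_eq_iff\<close>)
  have step: "runs (match_loop i 4 ;;
      Branch (\<lambda>h. h i = Sep \<and> h 4 = Blank) (set_flag a) (go 7 Stay) ;;
      skip_to i {Sep} ;; go i Go_Right ;; back_to 4 {Blank}) T (6 * Q + 18) ?T5"
    by (rule runs_Seq[OF 1 runs_Seq[OF 2 runs_Seq[OF 3 runs_Seq[OF 4 5 order_refl] order_refl] order_refl]]) simp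
  have "runs (scan_fields i a) ?T5 (length ws * (6 * Q + 20) + 1)
    (?T5(i := mk (rev (enc_tuple ws) @ Sep # ?m) [], 7 := mk [] [Bit (field_fold a z ws ?b)]))"
    by (rule Cons.IH) (use Cons.prems i in auto)
  also have "?T5(i := mk (rev (enc_tuple ws) @ Sep # ?m) [], 7 := mk [] [Bit (field_fold a z ws ?b)]) =
    T(i := mk (rev (enc_tuple (w # ws)) @ m) [], 7 := mk [] [Bit (field_fold a z (w # ws) b)])"
    by (auto simp: fun_eq_iff field_fold_def)
  finally have rest: "runs (scan_fields i a) ?T5 (length ws * (6 * Q + 20) + 1) \<dots>" .
  have ne: "hdb (enc_tuple (w # ws)) \<noteq> Blank"
    unfolding hdb_enc_tuple by simp
  show ?case
    unfolding scan_fields_def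
    by (rule runs_Loop_enter[OF _ step rest[unfolded scan_fields_def]]) (use ne Cons.prems in simp_all)
qed

text \<open>Scanning tape 6 leaves its head behind the last earlier string, precisely where the
  current one is then appended.\<close>

definition answer_field :: cmd where
  "answer_field =
     (copy_to 3 4 {Sep} ;; go 3 Go_Right ;; back_to 4 {Blank} ;; put 7 (Bit True) Stay ;;
      scan_fields 8 (\<lambda>_. False) ;; scan_fields 6 Not ;;
      emit 7 0 ;;
      copy_to 4 6 {Blank} ;; put 6 Sep Go_Right ;; erase 4 ;; back_to 8 {Blank} ;; back_to 6 {Blank})"

abbreviation st' :: "store \<Rightarrow> tape \<Rightarrow> tape \<Rightarrow> tape \<Rightarrow> tape \<Rightarrow> tape \<Rightarrow> tape \<Rightarrow> store" where
  "st' R u z c e g b \<equiv> R(0 := u, 3 := z, 4 := c, 6 := e, 7 := g, 8 := b)"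

text \<open>Tape 7 is empty in the first round and holds the previous answer in later ones;
  \<open>tl g = []\<close> covers both cases.\<close>

lemma runs_answer_field:
  assumes Q: "Suc (length z + length (enc_tuple es)) \<le> Q" "length (enc_tuple ws) \<le> Q"
    and g: "tl g = []"
  shows "runs answer_field
    (st' R (mk u []) (mk l (enc_string z @ Sep # r)) (mk [] []) (mk [] (enc_tuple es)) (mk [] g)
       (mk [] (enc_tuple ws)))
    (12 * Q * Q + 60 * Q + 60)
    (st' R (mk (Bit (verdict ws es z) # u) []) (mk (Sep # rev (enc_string z) @ l) r) (mk [] [])
       (mk [] (enc_tuple (es @ [z]))) (mk [] [Bit (verdict ws es z)]) (mk [] (enc_tuple ws)))"
proof -
  let ?S = "st' R"
  let ?e = "mk [] []"
  let ?l = "Sep # rev (enc_string z) @ l"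
  let ?z = "enc_string z"
  let ?E = "enc_tuple es"
  let ?W = "enc_tuple ws"
  let ?b = "field_fold (\<lambda>_. False) z ws True"
  let ?v = "Bit (verdict ws es z)"
  have lens: "length z \<le> Q" "length ?E \<le> Q" "length es \<le> Q" "length ws \<le> Q"
    using Q length_le_enc_tuple[of es] length_le_enc_tuple[of ws] by auto
  have fields: "\<forall>w \<in> set ws. length w \<le> Q" "\<forall>w \<in> set es. length w \<le> Q"
    using Q(2) lens(2) length_field_le by fastforce+
  have 1: "runs (copy_to 3 4 {Sep}) (?S (mk u []) (mk l (?z @ Sep # r)) ?e (mk [] ?E) (mk [] g) (mk [] ?W))
      (2 * Q + 1) (?S (mk u []) (mk (rev ?z @ l) (Sep # r)) (mk (rev ?z) []) (mk [] ?E) (mk [] g) (mk [] ?W))"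
    by (rule runs_copy_to[where xs = ?z and r = "Sep # r" and l = l and l' = "[]"])
      (use lens in \<open>auto simp: fun_eq_iff\<close>)
  have 2: "runs (go 3 Go_Right)
      (?S (mk u []) (mk (rev ?z @ l) (Sep # r)) (mk (rev ?z) []) (mk [] ?E) (mk [] g) (mk [] ?W)) 1
      (?S (mk u []) (mk ?l r) (mk (rev ?z) []) (mk [] ?E) (mk [] g) (mk [] ?W))"
    by (rule runs_go_right) (auto simp: fun_eq_iff)
  have 3: "runs (back_to 4 {Blank})
      (?S (mk u []) (mk ?l r) (mk (rev ?z) []) (mk [] ?E) (mk [] g) (mk [] ?W)) (2 * Q + 5)
      (?S (mk u []) (mk ?l r) (mk [] ?z) (mk [] ?E) (mk [] g) (mk [] ?W))"
    by (rule runs_back_to_start[where l = "rev ?z" and r = "[]"]) (use lens in \<open>auto simp: fun_eq_iff\<close>)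
  have 4: "runs (put 7 (Bit True) Stay)
      (?S (mk u []) (mk ?l r) (mk [] ?z) (mk [] ?E) (mk [] g) (mk [] ?W)) 1
      (?S (mk u []) (mk ?l r) (mk [] ?z) (mk [] ?E) (mk [] [Bit True]) (mk [] ?W))"
    by (rule runs_put) (use g in \<open>auto simp: fun_eq_iff act_stay\<close>)
  have loop_le: "length vs * (6 * Q + 20) + 1 \<le> Q * (6 * Q + 20) + 1" if "length vs \<le> Q" for vs :: "bool list list"
    using that by (intro add_mono mult_right_mono) auto
  have 5: "runs (scan_fields 8 (\<lambda>_. False))
      (?S (mk u []) (mk ?l r) (mk [] ?z) (mk [] ?E) (mk [] [Bit True]) (mk [] ?W)) (Q * (6 * Q + 20) + 1)
      (?S (mk u []) (mk ?l r) (mk [] ?z) (mk [] ?E) (mk [] [Bit ?b]) (mk (rev ?W) []))" (is "runs _ ?T _ ?T'")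
  proof -
    have "runs (scan_fields 8 (\<lambda>_. False)) ?T (length ws * (6 * Q + 20) + 1)
      (?T(8 := mk (rev ?W @ []) [], 7 := mk [] [Bit ?b]))"
      by (rule runs_scan_fields) (use lens fields in auto)
    also have "?T(8 := mk (rev ?W @ []) [], 7 := mk [] [Bit ?b]) = ?T'"
      by (auto simp: fun_eq_iff)
    finally show ?thesis
      by (rule runs_mono[OF _ loop_le[OF lens(4)]])
  qed
  have 6: "runs (scan_fields 6 Not)
      (?S (mk u []) (mk ?l r) (mk [] ?z) (mk [] ?E) (mk [] [Bit ?b]) (mk (rev ?W) [])) (Q * (6 * Q + 20) + 1)
      (?S (mk u []) (mk ?l r) (mk [] ?z) (mk (rev ?E) []) (mk [] [?v]) (mk (rev ?W) []))" (is "runs _ ?T _ ?T'")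
  proof -
    have "runs (scan_fields 6 Not) ?T (length es * (6 * Q + 20) + 1)
      (?T(6 := mk (rev ?E @ []) [], 7 := mk [] [Bit (field_fold Not z es ?b)]))"
      by (rule runs_scan_fields) (use lens fields in auto)
    also have "?T(6 := mk (rev ?E @ []) [], 7 := mk [] [Bit (field_fold Not z es ?b)]) = ?T'"
      by (auto simp: fun_eq_iff verdict_def)
    finally show ?thesis
      by (rule runs_mono[OF _ loop_le[OF lens(3)]])
  qed
  have 7: "runs (emit 7 0)
      (?S (mk u []) (mk ?l r) (mk [] ?z) (mk (rev ?E) []) (mk [] [?v]) (mk (rev ?W) [])) 1
      (?S (mk (?v # u) []) (mk ?l r) (mk [] ?z) (mk (rev ?E) []) (mk [] [?v]) (mk (rev ?W) []))"
    by (rule runs_emit) (auto simp: fun_eq_iff)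
  have 8: "runs (copy_to 4 6 {Blank})
      (?S (mk (?v # u) []) (mk ?l r) (mk [] ?z) (mk (rev ?E) []) (mk [] [?v]) (mk (rev ?W) [])) (2 * Q + 1)
      (?S (mk (?v # u) []) (mk ?l r) (mk (rev ?z) []) (mk (rev ?z @ rev ?E) []) (mk [] [?v]) (mk (rev ?W) []))"
    by (rule runs_copy_to[where xs = ?z and r = "[]" and l = "[]"]) (use lens in \<open>auto simp: fun_eq_iff\<close>)
  have 9: "runs (put 6 Sep Go_Right)
      (?S (mk (?v # u) []) (mk ?l r) (mk (rev ?z) []) (mk (rev ?z @ rev ?E) []) (mk [] [?v]) (mk (rev ?W) [])) 1
      (?S (mk (?v # u) []) (mk ?l r) (mk (rev ?z) []) (mk (Sep # rev ?z @ rev ?E) []) (mk [] [?v]) (mk (rev ?W) []))"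
    by (rule runs_put_end) (auto simp: fun_eq_iff)
  have 10: "runs (erase 4)
      (?S (mk (?v # u) []) (mk ?l r) (mk (rev ?z) []) (mk (Sep # rev ?z @ rev ?E) []) (mk [] [?v]) (mk (rev ?W) []))
      (2 * Q + 5)
      (?S (mk (?v # u) []) (mk ?l r) ?e (mk (Sep # rev ?z @ rev ?E) []) (mk [] [?v]) (mk (rev ?W) []))"
    by (rule runs_erase[where l = "rev ?z"]) (use lens in \<open>auto simp: fun_eq_iff\<close>)
  have 11: "runs (back_to 8 {Blank})
      (?S (mk (?v # u) []) (mk ?l r) ?e (mk (Sep # rev ?z @ rev ?E) []) (mk [] [?v]) (mk (rev ?W) [])) (2 * Q + 5)
      (?S (mk (?v # u) []) (mk ?l r) ?e (mk (Sep # rev ?z @ rev ?E) []) (mk [] [?v]) (mk [] ?W))"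
    by (rule runs_back_to_start[where l = "rev ?W" and r = "[]"]) (use Q in \<open>auto simp: fun_eq_iff\<close>)
  have 12: "runs (back_to 6 {Blank})
      (?S (mk (?v # u) []) (mk ?l r) ?e (mk (Sep # rev ?z @ rev ?E) []) (mk [] [?v]) (mk [] ?W)) (2 * Q + 5)
      (?S (mk (?v # u) []) (mk ?l r) ?e (mk [] (enc_tuple (es @ [z]))) (mk [] [?v]) (mk [] ?W))"
    by (rule runs_back_to_start[where l = "Sep # rev ?z @ rev ?E" and r = "[]"])
      (use Q in \<open>auto simp: fun_eq_iff\<close>)
  show ?thesis
    unfolding answer_field_def
    by (rule runs_Seq[OF 1 runs_Seq[OF 2 runs_Seq[OF 3 runs_Seq[OF 4 runs_Seq[OF 5 runs_Seq[OF 6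
          runs_Seq[OF 7 runs_Seq[OF 8 runs_Seq[OF 9 runs_Seq[OF 10 runs_Seq[OF 11 12
          order_refl] order_refl] order_refl] order_refl] order_refl] order_refl] order_refl] order_refl]
          order_refl] order_refl]])
      (simp add: algebra_simps)
qed

text \<open>Fields move from \<open>zs\<close> to \<open>es\<close>, so the sum of the encoded
  lengths is invariant and \<open>Q\<close> can stay fixed, as in the sorting loop.\<close>

lemma runs_answer_fields:
  assumes "length (enc_tuple zs) + length (enc_tuple es) \<le> Q" "length (enc_tuple ws) \<le> Q" "tl g = []"
  shows "\<exists>T. runs (Loop (\<lambda>h. h 3 \<noteq> Blank) answer_field)
    (st' R (mk u []) (mk l (enc_tuple zs)) (mk [] []) (mk [] (enc_tuple es)) (mk [] g)
       (mk [] (enc_tuple ws)))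
    (length zs * (12 * Q * Q + 60 * Q + 61) + 1) T \<and>
    T 0 = mk (rev (enc_string (verdicts ws es zs)) @ u) []"
  using assms
proof (induction zs arbitrary: es u l g)
  case Nil
  let ?T = "st' R (mk u []) (mk l (enc_tuple [])) (mk [] []) (mk [] (enc_tuple es)) (mk [] g)
       (mk [] (enc_tuple ws))"
  show ?case
    by (intro exI[of _ ?T] conjI runs_Loop_exit) (auto simp: enc_string_def)
next
  case (Cons z zs)
  let ?v = "Bit (verdict ws es z)"
  let ?T = "st' R (mk (?v # u) []) (mk (Sep # rev (enc_string z) @ l) (enc_tuple zs)) (mk [] [])
       (mk [] (enc_tuple (es @ [z]))) (mk [] [?v]) (mk [] (enc_tuple ws))"
  have step: "runs answer_field
    (st' R (mk u []) (mk l (enc_string z @ Sep # enc_tuple zs)) (mk [] []) (mk [] (enc_tuple es)) (mk [] g)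
       (mk [] (enc_tuple ws))) (12 * Q * Q + 60 * Q + 60) ?T"
    using Cons.prems by (intro runs_answer_field) auto
  have "\<exists>T. runs (Loop (\<lambda>h. h 3 \<noteq> Blank) answer_field) ?T (length zs * (12 * Q * Q + 60 * Q + 61) + 1) T \<and>
    T 0 = mk (rev (enc_string (verdicts ws (es @ [z]) zs)) @ ?v # u) []"
    by (rule Cons.IH) (use Cons.prems in auto)
  then obtain T where T: "runs (Loop (\<lambda>h. h 3 \<noteq> Blank) answer_field) ?T (length zs * (12 * Q * Q + 60 * Q + 61) + 1) T"
    "T 0 = mk (rev (enc_string (verdicts ws (es @ [z]) zs)) @ ?v # u) []"
    by blast
  have ne: "hdb (enc_tuple (z # zs)) \<noteq> Blank"
    unfolding hdb_enc_tuple by simp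
  show ?case
  proof (intro exI[of _ T] conjI)
    show "runs (Loop (\<lambda>h. h 3 \<noteq> Blank) answer_field)
      (st' R (mk u []) (mk l (enc_tuple (z # zs))) (mk [] []) (mk [] (enc_tuple es)) (mk [] g)
       (mk [] (enc_tuple ws))) (length (z # zs) * (12 * Q * Q + 60 * Q + 61) + 1) T"
      by (rule runs_Loop_enter[OF _ step[folded enc_tuple_simps(2)] T(1)]) (use ne in simp_all)
  qed (simp add: T(2) enc_string_def)
qed

section \<open>The complete program and its polynomial time bound\<close>

lemma wf_bubble: "8 < K \<Longrightarrow> {Blank, Sep} \<subseteq> A \<Longrightarrow> wf_cmd K A bubble"
  by (auto simp: bubble_def match_loop_def local_on_def)

lemma wf_sort_input: "8 < K \<Longrightarrow> {Blank, Sep} \<subseteq> A \<Longrightarrow> wf_cmd K A sort_input"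
  using wf_bubble by (auto simp: sort_input_def insert_field_def local_on_def)

lemma wf_answer_field:
  "8 < K \<Longrightarrow> {Blank, Bit False, Bit True, Sep} \<subseteq> A \<Longrightarrow> wf_cmd K A answer_field"
proof -
  assume K: "8 < K" and A: "{Blank, Bit False, Bit True, Sep} \<subseteq> A"
  have "Bit b \<in> A" for b
    using A by (cases b) auto
  then have "wf_cmd K A (set_flag a)" for a
    using K by (auto simp: set_flag_def local_on_def idle_def)
  then show ?thesis
    using K A by (auto simp: answer_field_def emit_def scan_fields_def match_loop_def local_on_def idle_def)
qed

lemma FP_verdicts:
  assumes "FP enc_tuple enc_tuple f"
  shows "FP enc_tuple enc_string (\<lambda>zs. verdicts (f (isort zs)) [] zs)"
proof -
  obtain M and p :: "nat poly" where M: "wf_tm M" and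
    run: "\<And>x. \<exists>t \<le> poly p (length (enc_tuple x)).
           let c = (step M ^^ t) (initial M (enc_tuple x))
           in fst c = halt M \<and> fst (hd (snd c)) = inscription (enc_tuple (f x))"
    using assms unfolding FP_def by blast
  have k: "1 \<le> tapes M" and alph: "{Blank, Bit False, Bit True, Sep} \<subseteq> alphabet M"
    and fin: "finite (states M)" "finite (alphabet M)"
    using M by (auto simp: wf_tm_def)
  define A where "A = alphabet M \<union> Aux ` states M"
  define P where "P = (sort_input ;; simulate M ;; Loop (\<lambda>h. h 3 \<noteq> Blank) answer_field)"
  \<comment> \<open>The value of \<open>[:1, 1:] + p\<close> at \<open>N\<close> is the number
    \<open>Q\<close> below, which bounds the input, the running time of \<open>M\<close> and the
    length of its output. Sorting and answering are cubic in \<open>Q\<close>; with all lower terms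
    charged to \<open>Q * Q * Q\<close>, the coefficients add up to less than 400.\<close>
  define p' where "p' = [:400:] * ([:1, 1:] + p) ^ 3"
  have A: "finite A" "{Blank, Bit False, Bit True, Sep} \<subseteq> A"
    using alph fin by (auto simp: A_def)
  have wf: "wf_cmd (8 + tapes M) A P"
    using wf_sort_input[of "8 + tapes M" A] wf_answer_field[of "8 + tapes M" A] A k
      wf_simulate[OF M, of A "8 + tapes M"]
    by (auto simp: P_def A_def local_on_def)
  show ?thesis
  proof (rule FP_cmd[OF _ A wf, of _ p'])
    fix zs
    define N where "N = length (enc_tuple zs)"
    define ys where "ys = isort zs"
    define ws where "ws = f ys"
    have lenys: "length (enc_tuple ys) = N"
      by (simp add: ys_def N_def length_enc_isort)
    obtain t where t: "t \<le> poly p N" "fst ((step M ^^ t) (initial M (enc_tuple ys))) = halt M"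
      "fst (hd (snd ((step M ^^ t) (initial M (enc_tuple ys))))) = inscription (enc_tuple ws)"
      using run[of ys] by (auto simp: Let_def lenys ws_def)
    obtain ts where ts: "(step M ^^ t) (initial M (enc_tuple ys)) = (halt M, ts)"
      using t(2) by (cases "(step M ^^ t) (initial M (enc_tuple ys))") auto
    have sub: "set (enc_tuple ys) \<subseteq> alphabet M"
    proof -
      have "Bit b \<in> alphabet M" for b
        using alph by (cases b) auto
      then show ?thesis
        using set_enc_tuple[of ys] alph by blast
    qed
    have "valid_config M ((step M ^^ t) (initial M (enc_tuple ys)))"
      by (induction t) (auto simp: valid_initial[OF M sub] valid_step[OF M])
    then have "ts \<noteq> []"
      using k by (auto simp: ts valid_config_def)
    then have out: "fst (ts ! 0) = inscription (enc_tuple ws)"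
      using t(3) by (simp add: ts hd_conv_nth)
    define Q where "Q = N + poly p N + 1"
    have lenws: "length (enc_tuple ws) \<le> Q"
      using length_output_le[OF ts M sub out] lenys t(1) by (simp add: Q_def)
    let ?T1 = "((\<lambda>_. mk [] [])(3 := mk [] (enc_tuple zs), 8 := mk [] (enc_tuple ys))) :: store"
    have 1: "runs sort_input (init_store (enc_tuple zs)) (N * (20 * N * N + 60 * N + 61) + 8 * N + 30) ?T1"
      unfolding ys_def by (rule runs_sort_input) (simp add: N_def)
    have "\<exists>T'. runs (simulate M) ?T1 (4 * t + 20) T' \<and> T' 8 = mk [] (enc_tuple ws) \<and>
      (\<forall>i. i \<noteq> 1 \<and> i \<noteq> 2 \<and> i < 8 \<longrightarrow> T' i = ?T1 i)"
      by (rule runs_simulate[OF M sub ts out]) auto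
    then obtain T2 where 2: "runs (simulate M) ?T1 (4 * t + 20) T2" and T2: "T2 8 = mk [] (enc_tuple ws)"
      "\<forall>i. i \<noteq> 1 \<and> i \<noteq> 2 \<and> i < 8 \<longrightarrow> T2 i = ?T1 i"
      by blast
    \<comment> \<open>The simulation leaves tapes 0, 4, 6 and 7 empty and the input on tape 3, which
      is the store from which the answering loop starts.\<close>
    have "T2 = st' T2 (mk [] []) (mk [] (enc_tuple zs)) (mk [] []) (mk [] (enc_tuple [])) (mk [] [])
        (mk [] (enc_tuple ws))"
      using T2 by (auto simp: fun_eq_iff)
    moreover have "\<exists>T. runs (Loop (\<lambda>h. h 3 \<noteq> Blank) answer_field)
      (st' T2 (mk [] []) (mk [] (enc_tuple zs)) (mk [] []) (mk [] (enc_tuple [])) (mk [] [])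
        (mk [] (enc_tuple ws)))
      (length zs * (12 * Q * Q + 60 * Q + 61) + 1) T \<and>
      T 0 = mk (rev (enc_string (verdicts ws [] zs)) @ []) []"
      by (rule runs_answer_fields) (use lenws in \<open>auto simp: Q_def N_def\<close>)
    ultimately obtain T where 3: "runs (Loop (\<lambda>h. h 3 \<noteq> Blank) answer_field) T2
      (length zs * (12 * Q * Q + 60 * Q + 61) + 1) T" and T: "T 0 = mk (rev (enc_string (verdicts ws [] zs))) []"
      by auto
    have NQ: "N \<le> Q" "t \<le> Q" "length zs \<le> Q" "1 \<le> Q"
      using t(1) length_le_enc_tuple[of zs] by (auto simp: Q_def N_def)
    have "N * (20 * N * N + 60 * N + 61) \<le> Q * (20 * Q * Q + 60 * Q + 61)"
      "length zs * (12 * Q * Q + 60 * Q + 61) \<le> Q * (12 * Q * Q + 60 * Q + 61)"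
      using NQ by (intro mult_mono add_mono; simp)+
    moreover have "Q \<le> Q * Q" "Q * Q \<le> Q * Q * Q"
      using NQ(4) by auto
    moreover have "Q * (20 * Q * Q + 60 * Q + 61) = 20 * (Q * Q * Q) + 60 * (Q * Q) + 61 * Q"
      "Q * (12 * Q * Q + 60 * Q + 61) = 12 * (Q * Q * Q) + 60 * (Q * Q) + 61 * Q"
      by (simp_all add: algebra_simps)
    ultimately have bound: "Suc (N * (20 * N * N + 60 * N + 61) + 8 * N + 30 +
        Suc (4 * t + 20 + (length zs * (12 * Q * Q + 60 * Q + 61) + 1))) \<le> 400 * (Q * Q * Q)"
      using NQ by linarith
    have "poly p' N = 400 * (Q * Q * Q)"
      by (simp add: p'_def Q_def power3_eq_cube algebra_simps)
    then have "runs P (init_store (enc_tuple zs)) (poly p' N) T"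
      unfolding P_def by (intro runs_Seq[OF 1 runs_Seq[OF 2 3 order_refl]]) (simp only: bound)
    moreover have "fst (T 0) = inscription (enc_string (verdicts ws [] zs))"
      by (simp add: T mk_def)
    ultimately show "\<exists>T. runs P (init_store (enc_tuple zs)) (poly p' (length (enc_tuple zs))) T \<and>
      fst (T 0) = inscription (enc_string (verdicts (f (isort zs)) [] zs))"
      by (auto simp: N_def ws_def ys_def)
  qed (use k in simp)
qed

section \<open>Every vector of answers is wrong somewhere\<close>

lemma length_verdicts [simp]: "length (verdicts ws es zs) = length zs"
  by (induction zs arbitrary: es) auto

lemma verdicts_nth: "i < length zs \<Longrightarrow> verdicts ws es zs ! i = verdict ws (es @ take i zs) (zs ! i)"
  by (induction zs arbitrary: es i) (auto simp: nth_Cons' take_Cons')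

lemma field_fold_notin: "z \<notin> set ws \<Longrightarrow> field_fold a z ws b = b"
  by (induction ws arbitrary: b) (auto simp: field_fold_def)

lemma verdict_fresh: "z \<notin> set es \<Longrightarrow> verdict ws es z \<longleftrightarrow> z \<notin> set ws"
proof -
  have "field_fold (\<lambda>_. False) z ws b \<longleftrightarrow> b \<and> z \<notin> set ws" for b
    by (induction ws arbitrary: b) (auto simp: field_fold_def)
  then show "z \<notin> set es \<Longrightarrow> ?thesis"
    by (simp add: verdict_def field_fold_notin)
qed

text \<open>The contribution of \<open>ws\<close> is the same at both positions, and the single
  earlier occurrence of \<open>z\<close> negates it once.\<close>

lemma verdict_second:
  "z \<notin> set us \<Longrightarrow> z \<notin> set vs \<Longrightarrow> verdict ws (us @ z # vs) z \<longleftrightarrow> \<not> verdict ws us z"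
  using field_fold_notin[of z us Not] field_fold_notin[of z vs Not]
  by (simp add: verdict_def field_fold_def)

text \<open>The first two occurrences of a string receive opposite answers although membership in
  \<open>L\<close> is the same, so one of the two answers is wrong, whatever \<open>L\<close> and
  \<open>ws\<close> are.\<close>

lemma verdicts_differ_duplicate:
  assumes "\<not> distinct zs"
  shows "map (\<lambda>z. z \<in> L) zs \<noteq> verdicts ws [] zs"
proof
  assume eq: "map (\<lambda>z. z \<in> L) zs = verdicts ws [] zs"
  have nth: "zs ! i \<in> L \<longleftrightarrow> verdict ws (take i zs) (zs ! i)" if "i < length zs" for i
    using arg_cong[OF eq, of "\<lambda>xs. xs ! i"] that by (simp add: verdicts_nth)
  \<comment> \<open>Distinctness of \<open>xs\<close> makes this the second occurrence of
    \<open>z\<close>; at a third one the two flips would cancel.\<close>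
  obtain xs z ys where zs: "zs = xs @ z # ys" "distinct xs" "z \<in> set xs"
    using assms not_distinct_conv_prefix by metis
  obtain us vs where xs: "xs = us @ z # vs" "z \<notin> set us"
    using split_list_first[OF zs(3)] by blast
  then have "z \<notin> set vs"
    using zs(2) by auto
  then have "verdict ws xs z \<longleftrightarrow> \<not> verdict ws us z"
    using xs verdict_second by simp
  moreover have "z \<in> L \<longleftrightarrow> verdict ws us z"
    using nth[of "length us"] by (simp add: zs xs)
  moreover have "z \<in> L \<longleftrightarrow> verdict ws xs z"
    using nth[of "length xs"] by (simp add: zs)
  ultimately show False
    by blast
qed

lemma verdicts_distinct:
  assumes "distinct zs"
  shows "verdicts ws [] zs = map (\<lambda>z. z \<notin> set ws) zs"
proof (rule nth_equalityI)
  fix i assume "i < length (verdicts ws [] zs)"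
  moreover from this have "zs ! i \<notin> set (take i zs)"
    using assms by (auto simp: in_set_conv_nth nth_eq_iff_index_eq)
  ultimately show "verdicts ws [] zs ! i = map (\<lambda>z. z \<notin> set ws) zs ! i"
    by (simp add: verdicts_nth verdict_fresh)
qed simp

theorem theorem4p3: "Fair_GC half half (\<lambda>n. 1) \<subseteq> P_mc_poly"
proof
  fix L assume "L \<in> Fair_GC half half (\<lambda>n. 1)"
  then obtain f where f: "FP enc_tuple enc_tuple f"
    and sel: "\<And>n ys. n \<ge> 1 \<Longrightarrow> length ys = n \<Longrightarrow> sorted_wrt lex_less ys \<Longrightarrow>
             (\<forall>y \<in> set ys. length y \<le> n) \<Longrightarrow>
           set (f ys) \<subseteq> set ys \<and> card (set (f ys)) \<le> half n \<and>
           (card (L \<inter> set ys) \<ge> half n \<longrightarrow> card (L \<inter> set (f ys)) \<ge> 1)"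
    unfolding Fair_GC_def by blast
  let ?h = "\<lambda>zs. verdicts (f (isort zs)) [] zs"
  \<comment> \<open>With 1 in place of 2, the single empty string would already be a query. As
    \<open>half 1 = 1\<close>, \<open>f\<close> could select it, and no string would remain outside
    \<open>?F\<close>. For \<open>?n \<ge> 2\<close> at most \<open>?n div 2\<close> strings are
    selected, and at least as many remain.\<close>
  have differ: "map (\<lambda>z. z \<in> L) zs \<noteq> ?h zs"
    if zs: "zs \<noteq> []" "Max (length ` set zs) + 2 \<le> length zs" for zs
  proof (cases "distinct zs")
    case True
    let ?n = "length zs"
    let ?F = "set (f (isort zs))"
    have "length z \<le> ?n" if "z \<in> set zs" for z
    proof -
      have "length z \<le> Max (length ` set zs)"
        using that by (intro Max_ge) auto
      then show ?thesis
        using zs(2) by linarith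
    qed
    moreover have n: "2 \<le> ?n"
      using zs(2) by simp
    ultimately have F: "?F \<subseteq> set zs" "card ?F \<le> half ?n"
      "half ?n \<le> card (L \<inter> set zs) \<Longrightarrow> 1 \<le> card (L \<inter> ?F)"
      using sel[of ?n "isort zs"] sorted_isort[OF True] by (auto simp: length_isort set_isort)
    show ?thesis
    proof
      assume "map (\<lambda>z. z \<in> L) zs = ?h zs"
      then have L: "z \<in> L \<longleftrightarrow> z \<notin> ?F" if "z \<in> set zs" for z
        using that by (simp add: verdicts_distinct[OF True])
      have "L \<inter> set zs = set zs - ?F" "L \<inter> ?F = {}"
        using L F(1) by blast+
      moreover have "card (set zs - ?F) = ?n - card ?F"
        using F(1) True by (simp add: card_Diff_subset distinct_card)
      moreover have "half ?n \<le> ?n - card ?F"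
        using F(2) n by (simp add: half_def)
      ultimately show False
        using F(3) by simp
    qed
  next
    case False
    then show ?thesis
      by (rule verdicts_differ_duplicate)
  qed
  have "L \<in> P_mc (\<lambda>n. n + 2)"
    unfolding P_mc_def using FP_verdicts[OF f] differ by (intro CollectI exI[of _ ?h]) simp
  moreover have "\<exists>p :: real poly. \<forall>n. real (n + 2) = poly p (real n)"
    by (rule exI[of _ "[:2, 1:]"]) simp
  ultimately show "L \<in> P_mc_poly"
    unfolding P_mc_poly_def
    by (intro UnionI[of "P_mc (\<lambda>n. n + 2)"] CollectI exI[of _ "\<lambda>n. n + 2"] conjI) (auto simp: mono_def)
qed

end
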